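(* Let $\mathcal{A}=\{1,\dots,L\}$, let $Q$ be a pmf on $\mathcal{A}$ with $q_{\min}=\min_aQ(a)>0$ and $q_{\max}=\max_aQ(a)$, let $f:\mathcal{A}\to\mathbb{R}$, and let $I$ satisfy $\min_af(a)<I<E_f(Q)$. Let $\mathcal{E}=\{P: E_f(P)\le I\}$ and $P^*=\arg\min_{P\in\mathcal{E}}D(P\|Q)$, with minimum and maximum probabilities $p^*_{\min}$ and $p^*_{\max}$. For each $n$, let $\mathcal{S}_n=\{a^n\in\mathcal{A}^n: \pi(a^n)\in\mathcal{E}\}$, let $P_{A^n}(a^n)=Q^n(a^n)/Q^n(\mathcal{S}_n)$ for $a^n\in\mathcal{S}_n$ (and $0$ otherwise), and let $\bar\pi=\bar\pi_n=\sum_{a^n}P_{A^n}(a^n)\pi(a^n)$. Define $\Delta(P)=D(P\|Q)-D(P^*\|Q)$ and \[ \tilde c=(L-1)\log_2\frac{p^*_{\max}\,q_{\max}}{p^*_{\min}\,q_{\min}}. \] Then, as $n\to\infty$, \[ D(\bar\pi\|P^* )\le\Delta(\bar\pi)<\frac1n\,2^{\tilde c+1}(1+o(1)). \]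
   Context: $E_f(P)=\sum_aP(a)f(a)$ for a pmf $P$ on $\mathcal{A}$. $D(P\|Q)=\sum_{a:P(a)>0}P(a)\log_2\frac{P(a)}{Q(a)}$. $Q^n$ is the iid pmf on $\mathcal{A}^n$. The empirical pmf of $a^n$ is $\pi(a^n)=\frac1n[n_1,\dots,n_L]$, with $n_i$ the number of occurrences of letter $i$. ($\mathcal{S}_n$ is nonempty for all sufficiently large $n$.) The minimizer $P^*$ has the form $P^*(a)=Q(a)2^{-\tau f(a)}/\sum_bQ(b)2^{-\tau f(b)}$ with $\tau>0$ and $E_f(P^* )=I$, so $p^*_{\min}>0$. *)

theory Defs
  imports "HOL-Analysis.Analysis"
begin

definition is_pmf :: "('a::finite \<Rightarrow> real) \<Rightarrow> bool" where
  "is_pmf P \<longleftrightarrow> (\<forall>a. P a \<ge> 0) \<and> (\<Sum>a\<in>UNIV. P a) = 1"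

definition expect :: "('a::finite \<Rightarrow> real) \<Rightarrow> ('a \<Rightarrow> real) \<Rightarrow> real" where
  "expect f P = (\<Sum>a\<in>UNIV. P a * f a)"

definition kl_div :: "('a::finite \<Rightarrow> real) \<Rightarrow> ('a \<Rightarrow> real) \<Rightarrow> real" where
  "kl_div P Q = (\<Sum>a\<in>{a. P a > 0}. P a * log 2 (P a / Q a))"

definition emp_pmf :: "'a list \<Rightarrow> 'a \<Rightarrow> real" where
  "emp_pmf xs a = real (count_list xs a) / real (length xs)"

definition iid :: "('a \<Rightarrow> real) \<Rightarrow> 'a list \<Rightarrow> real" where
  "iid Q xs = prod_list (map Q xs)"

definition constr_set :: "('a::finite \<Rightarrow> real) \<Rightarrow> real \<Rightarrow> ('a \<Rightarrow> real) set" where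
  "constr_set f I = {P. is_pmf P \<and> expect f P \<le> I}"

definition typical_set :: "('a::finite \<Rightarrow> real) \<Rightarrow> real \<Rightarrow> nat \<Rightarrow> 'a list set" where
  "typical_set f I n = {xs. length xs = n \<and> emp_pmf xs \<in> constr_set f I}"

definition cond_pmf :: "('a::finite \<Rightarrow> real) \<Rightarrow> ('a \<Rightarrow> real) \<Rightarrow> real \<Rightarrow> nat \<Rightarrow> 'a list \<Rightarrow> real" where
  "cond_pmf Q f I n xs =
     (if xs \<in> typical_set f I n
      then iid Q xs / (\<Sum>ys\<in>typical_set f I n. iid Q ys) else 0)"

definition mean_type :: "('a::finite \<Rightarrow> real) \<Rightarrow> ('a \<Rightarrow> real) \<Rightarrow> real \<Rightarrow> nat \<Rightarrow> 'a \<Rightarrow> real" where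
  "mean_type Q f I n a =
     (\<Sum>xs\<in>{xs. length xs = n}. cond_pmf Q f I n xs * emp_pmf xs a)"

end

theory Submission
  imports Defs "HOL-Combinatorics.Multiset_Permutations" "HOL-Real_Asymp.Real_Asymp"
begin

text \<open>
  The minimiser is a tilting \<open>P \<propto> Q exp (- \<theta> f)\<close> with mean \<open>I\<close>, so for every pmf \<open>R\<close>
  \<open>D(R|Q) - D(P|Q) = D(R|P) + \<theta> (I - E\<^sub>f R) / ln 2\<close>, and both terms on the right have to be bounded
  at the mean type. In terms of letter counts \<open>N\<close>, the conditional law has weights
  \<open>P\<^sup>n(N) exp (- \<theta> s(N))\<close> on \<open>s(N) = n I - \<Sum> N f \<ge> 0\<close>, and counts outside a window of width
  \<open>n\<^bsup>3/5\<^esup>\<close> around \<open>n P\<close> are negligible. Inside the window \<open>P\<^sup>n(N + v) / P\<^sup>n(N)\<close> is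
  \<open>exp (q(N) - q(N + v) + o(1))\<close> with \<open>q(N) = \<Sum> (N - n P)\<^sup>2 / (2 n P)\<close>. Fix letters with
  \<open>f a < f b\<close> and put \<open>X = \<theta> (f b - f a)\<close>.

  Exchanging one letter \<open>a\<close> for a \<open>b\<close> multiplies weights by about \<open>exp X\<close>, which gives
  \<open>\<theta> E[s] \<le> X / (1 - exp (- X)) + o(1) \<le> X + 1\<close>. Shifting instead by an integer vector \<open>v\<close> within
  \<open>O(1)\<close> of \<open>-u\<close>, where \<open>u = E[N] - n P\<close>, and rounded so that \<open>s\<close> grows by at most \<open>f b - f a\<close>,
  maps the feasible counts into themselves; as the shifted weights sum to at most the total weight,
  \<open>exp t \<ge> 1 + t\<close> yields \<open>\<Sum> u\<^sup>2 / (2 n P) \<le> X + o(1)\<close>, which is \<open>n D(mean type|P)\<close> in nats up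
  to \<open>o(1)\<close>. The total \<open>2 X + 1 + o(1)\<close> stays strictly below \<open>2 ln 2 exp X\<close>, and \<open>exp X\<close> is
  a ratio of the probabilities entering \<open>c\<close>; hence the error \<open>g\<close> can even be taken to be \<open>0\<close>.
\<close>

section \<open>Sums over sequences and over letter counts\<close>

text \<open>Types are kept as integer count vectors rather than as frequencies, so that integer
  vectors can act on them by translation.\<close>

definition types :: "nat \<Rightarrow> ('a::finite \<Rightarrow> nat) set" where
  "types n = {N. sum N UNIV = n}"

text \<open>For a pmf \<open>P\<close> this is the multinomial probability of the counts
  \<open>N\<close>. It is also applied to unnormalised weights, in \<open>chernoff\<close>.\<close>

definition mass :: "('a::finite \<Rightarrow> real) \<Rightarrow> ('a \<Rightarrow> nat) \<Rightarrow> real" where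
  "mass P N = fact (sum N UNIV) * (\<Prod>a\<in>UNIV. P a ^ N a / fact (N a))"

lemma types_le: "N \<in> types n \<Longrightarrow> N a \<le> n"
  unfolding types_def using member_le_sum[of a UNIV N] by auto

lemma types_subset: "types n \<subseteq> PiE UNIV (\<lambda>_. {..n})"
  using types_le by auto

lemma finite_types [simp]: "finite (types n)"
  by (rule finite_subset[OF types_subset]) (auto intro: finite_PiE)

lemma card_types_le: "card (types n :: ('a::finite \<Rightarrow> nat) set) \<le> (n + 1) ^ CARD('a)"
proof -
  have "card (types n :: ('a \<Rightarrow> nat) set) \<le> card (PiE (UNIV::'a set) (\<lambda>_. {..n}))"
    by (rule card_mono[OF _ types_subset]) (auto intro: finite_PiE)
  then show ?thesis by (simp add: card_PiE)
qed

lemma iid_eq_prod_count: "iid Q xs = (\<Prod>a\<in>UNIV. Q a ^ count_list xs a)"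
  for xs :: "'a::finite list"
proof (induction xs)
  case (Cons x xs)
  have "(\<Prod>a\<in>UNIV. Q a ^ count_list (x # xs) a)
      = (\<Prod>a\<in>UNIV. (if a = x then Q a else 1) * Q a ^ count_list xs a)"
    by (intro prod.cong) auto
  also have "\<dots> = Q x * (\<Prod>a\<in>UNIV. Q a ^ count_list xs a)"
    by (simp add: prod.distrib)
  finally show ?case using Cons by (simp add: iid_def)
qed (simp add: iid_def)

lemma count_list_in_types: "count_list xs \<in> types (length xs)" for xs :: "'a::finite list"
  by (simp add: types_def sum_count_set)

lemma finite_lists_length [simp]: "finite {xs :: 'a::finite list. length xs = n}"
  using finite_lists_length_eq[of "UNIV :: 'a set" n] by simp

text \<open>Sequences with equal counts have equal iid probability, and the sequences with counts
  \<open>N\<close> are the permutations of one multiset, so their number is a multinomial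
  coefficient.\<close>

lemma sum_iid_type_class:
  fixes N :: "'a::finite \<Rightarrow> nat"
  assumes "N \<in> types n"
  shows "(\<Sum>xs | length xs = n \<and> count_list xs = N. iid Q xs) = mass Q N"
proof -
  define A where "A = Abs_multiset N"
  have cA: "count A a = N a" for a
    unfolding A_def by simp
  have szA: "size A = n"
  proof -
    have "size A = (\<Sum>a\<in>UNIV. count A a)"
      unfolding size_multiset_overloaded_eq
      by (rule sum.mono_neutral_left) (auto simp: count_eq_zero_iff)
    then show ?thesis using assms by (simp add: cA types_def)
  qed
  have "{xs. length xs = n \<and> count_list xs = N} = permutations_of_multiset A"
  proof -
    have "count_list xs = N \<longleftrightarrow> mset xs = A" for xs
      by (auto simp: multiset_eq_iff cA fun_eq_iff count_mset)
    moreover have "mset xs = A \<Longrightarrow> length xs = n" for xs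
      using szA by auto
    ultimately show ?thesis unfolding permutations_of_multiset_def by auto
  qed
  moreover have "(\<Sum>xs | length xs = n \<and> count_list xs = N. iid Q xs)
     = real (card {xs. length xs = n \<and> count_list xs = N}) * (\<Prod>a\<in>UNIV. Q a ^ N a)"
    by (simp add: iid_eq_prod_count)
  moreover have "real (card (permutations_of_multiset A)) = fact n / (\<Prod>a\<in>UNIV. fact (N a))"
  proof -
    \<comment> \<open>Letters outside the multiset contribute the factor
      \<open>fact 0 = 1\<close>.\<close>
    have "(\<Prod>x\<in>set_mset A. fact (count A x)) = (\<Prod>x\<in>UNIV. fact (count A x) :: nat)"
      by (rule prod.mono_neutral_left) (auto simp: not_in_iff)
    then have "card (permutations_of_multiset A) = fact n div (\<Prod>x\<in>UNIV. fact (N x))"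
      and "(\<Prod>x\<in>UNIV. fact (N x)) dvd (fact n :: nat)"
      using card_permutations_of_multiset[of A] by (auto simp: cA szA)
    then show ?thesis by (simp add: real_of_nat_div)
  qed
  ultimately show ?thesis
    using assms by (simp add: mass_def types_def prod_dividef)
qed

text \<open>The bridge from sums over sequences to sums over counts: it yields both the multinomial
  theorem \<open>sum_mass\<close> and the reduction of \<open>mean_type\<close>.\<close>

lemma sum_lists_by_type:
  fixes Q :: "'a::finite \<Rightarrow> real" and G :: "('a \<Rightarrow> nat) \<Rightarrow> real"
  shows "(\<Sum>xs | length xs = n. iid Q xs * G (count_list xs)) = (\<Sum>N\<in>types n. mass Q N * G N)"
proof -
  have "(\<Sum>xs | length xs = n. iid Q xs * G (count_list xs))
      = (\<Sum>N\<in>types n. \<Sum>xs | xs \<in> {xs. length xs = n} \<and> count_list xs = N. iid Q xs * G (count_list xs))"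
    by (rule sum.group[symmetric]) (use count_list_in_types in auto)
  also have "\<dots> = (\<Sum>N\<in>types n. (\<Sum>xs | length xs = n \<and> count_list xs = N. iid Q xs) * G N)"
    by (intro sum.cong refl) (simp add: sum_distrib_right)
  also have "\<dots> = (\<Sum>N\<in>types n. mass Q N * G N)"
    by (intro sum.cong refl) (simp add: sum_iid_type_class)
  finally show ?thesis .
qed

lemma sum_iid_lists: "(\<Sum>xs | length xs = n. iid Q xs) = (sum Q UNIV) ^ n"
  for Q :: "'a::finite \<Rightarrow> real"
proof (induction n)
  case (Suc n)
  have *: "{xs :: 'a list. length xs = Suc n} = (\<lambda>(x, xs). x # xs) ` (UNIV \<times> {xs. length xs = n})"
    by (auto simp: length_Suc_conv image_iff)
  have "(\<Sum>xs | length xs = Suc n. iid Q xs)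
     = (\<Sum>(x, xs)\<in>UNIV \<times> {xs. length xs = n}. Q x * iid Q xs)"
    unfolding * by (subst sum.reindex) (auto simp: inj_on_def iid_def intro!: sum.cong)
  also have "\<dots> = (\<Sum>x\<in>UNIV. \<Sum>xs | length xs = n. Q x * iid Q xs)"
    by (simp add: sum.cartesian_product)
  also have "\<dots> = sum Q UNIV * (sum Q UNIV) ^ n"
    by (simp flip: sum_distrib_left sum_distrib_right add: Suc)
  finally show ?case by simp
qed (simp add: iid_def)

lemma sum_mass: "(\<Sum>N\<in>types n. mass Q N) = (sum Q UNIV) ^ n"
  for Q :: "'a::finite \<Rightarrow> real"
  using sum_lists_by_type[of Q "\<lambda>_. 1" n] by (simp add: sum_iid_lists)

section \<open>Elementary estimates\<close>

text \<open>The left difference is a sum of logarithms of the integers between \<open>i\<close> and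
  \<open>j\<close>. Expanding each around \<open>m\<close> to first order and summing gives the
  linear and quadratic terms; \<open>h / m\<close> at most 1/2 controls the second-order remainder
  of each step.\<close>

lemma ln_fact_diff:
  fixes m h :: real
  assumes m: "m > 0" and h: "h \<le> m / 2"
    and i: "\<bar>real i - m\<bar> \<le> h" and j: "\<bar>real j - m\<bar> \<le> h"
  shows "\<bar>ln (fact j) - ln (fact i)
           - ((real j - real i) * ln m + ((real j - m)\<^sup>2 - (real i - m)\<^sup>2) / (2 * m))\<bar>
         \<le> \<bar>real j - real i\<bar> * (2 * h\<^sup>2 / m\<^sup>2 + 1 / (2 * m))"
proof -
  define D where "D i j = ln (fact j) - ln (fact i)
           - ((real j - real i) * ln m + ((real j - m)\<^sup>2 - (real i - m)\<^sup>2) / (2 * m))" for i j :: nat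
  define K where "K = 2 * h\<^sup>2 / m\<^sup>2 + 1 / (2 * m)"
  have up: "i \<le> j \<Longrightarrow> \<bar>real i - m\<bar> \<le> h \<Longrightarrow> \<bar>real j - m\<bar> \<le> h \<Longrightarrow> \<bar>D i j\<bar> \<le> (real j - real i) * K" for i j
  proof (induction j rule: dec_induct)
    case (step j)
    define t where "t = (real (Suc j) - m) / m"
    have th: "\<bar>t\<bar> \<le> h / m" using step.prems m by (simp add: t_def divide_simps)
    also have "h / m \<le> 1 / 2" using h m by (simp add: divide_simps)
    finally have "\<bar>ln (1 + t) - t\<bar> \<le> 2 * t\<^sup>2" by (rule abs_ln_one_plus_x_minus_x_bound)
    also have "t\<^sup>2 \<le> (h / m)\<^sup>2" using power_mono[OF th, of 2] by simp
    finally have 1: "\<bar>ln (1 + t) - t\<bar> \<le> 2 * h\<^sup>2 / m\<^sup>2" by (simp add: power_divide)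
    have "1 + t = real (Suc j) / m" using m by (simp add: t_def field_simps)
    then have lt: "ln (1 + t) = ln (real (Suc j)) - ln m"
      using m by (simp add: ln_div)
    have lf: "ln (fact (Suc j) :: real) = ln (real (Suc j)) + ln (fact j)"
      by (simp add: ln_mult)
    \<comment> \<open>\<open>t\<close> is taken at the right end \<open>Suc j\<close> of the step,
      while the difference of squares sees its midpoint; this offset is the term
      \<open>1 / (2 * m)\<close> in \<open>K\<close>.\<close>
    have q: "((real (Suc j) - m)\<^sup>2 - (real j - m)\<^sup>2) / (2 * m) = t - 1 / (2 * m)"
      using m by (simp add: t_def field_simps power2_eq_square)
    have "D i (Suc j) = D i j + (ln (1 + t) - t + 1 / (2 * m))"
      unfolding D_def using q lt lf by (simp add: diff_divide_distrib algebra_simps)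
    moreover have "\<bar>D i j\<bar> \<le> (real j - real i) * K"
      using step.IH step.prems step.hyps by auto
    moreover have "\<bar>ln (1 + t) - t + 1 / (2 * m)\<bar> \<le> K"
      unfolding K_def using 1 m zero_le_divide_1_iff[of "2 * m"] by linarith
    moreover have "(real (Suc j) - real i) * K = (real j - real i) * K + K"
      by (simp add: algebra_simps)
    ultimately show ?case by linarith
  qed (simp add: D_def)
  \<comment> \<open>Antisymmetry reduces \<open>j < i\<close> to the induction upwards.\<close>
  have "D j i = - D i j" by (simp add: D_def diff_divide_distrib algebra_simps)
  with up[of i j] up[of j i] i j have "\<bar>D i j\<bar> \<le> \<bar>real j - real i\<bar> * K"
    by (cases "i \<le> j") auto
  then show ?thesis by (simp add: D_def K_def)
qed

lemma tendsto_le_eventually: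
  fixes F :: "nat \<Rightarrow> real"
  assumes "F \<longlonglongrightarrow> l" "l < u" shows "\<forall>\<^sub>F n in sequentially. F n \<le> u"
  using order_tendstoD(2)[OF assms] by (rule eventually_mono) simp

lemma mass_pos: "(\<And>a. P a > 0) \<Longrightarrow> mass P N > 0"
  unfolding mass_def by (intro mult_pos_pos prod_pos) auto

lemma mass_scale: "mass (\<lambda>a. P a * g a) N = mass P N * (\<Prod>a\<in>UNIV. g a ^ N a)"
  by (simp add: mass_def power_mult_distrib prod.distrib prod_dividef)

text \<open>Subtracting \<open>ln (1 + t)\<close> from its cubic Taylor polynomial leaves a function
  with derivative \<open>t ^ 3 / (1 + t)\<close>, hence with minimum 0 at 0. The quadratic term is
  the one that turns relative entropy into a chi-square expression.\<close>

lemma mult_ln_le_cubic: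
  fixes y :: real
  assumes "\<bar>y\<bar> < 1"
  shows "(1 + y) * ln (1 + y) \<le> y + y\<^sup>2 / 2 + \<bar>y\<bar> ^ 3"
proof -
  define g where "g t = t - t\<^sup>2 / 2 + t ^ 3 / 3 - ln (1 + t)" for t :: real
  have der: "(g has_real_derivative t ^ 3 / (1 + t)) (at t)" if "t > -1" for t
    unfolding g_def using that
    by (auto intro!: derivative_eq_intros simp: field_simps power2_eq_square power3_eq_cube)
  have der_ge: "t ^ 3 / (1 + t) \<ge> 0" if "t \<ge> 0" for t :: real
    using that by simp
  have der_le: "t ^ 3 / (1 + t) \<le> 0" if "t \<le> 0" "t > -1" for t :: real
    using that by (intro divide_nonpos_pos) (auto simp: power3_eq_cube mult_nonneg_nonpos)
  have "g y \<ge> g 0"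
  proof (cases "y \<ge> 0")
    case True
    show ?thesis
    proof (rule DERIV_nonneg_imp_nondecreasing[OF True])
      fix t :: real assume "0 \<le> t" "t \<le> y"
      then show "\<exists>D. (g has_real_derivative D) (at t) \<and> D \<ge> 0"
        using der[of t] der_ge[of t] by (intro exI[of _ "t ^ 3 / (1 + t)"]) auto
    qed
  next
    case False
    show ?thesis
    proof (rule DERIV_nonpos_imp_nonincreasing[of y 0 g])
      fix t :: real assume "y \<le> t" "t \<le> 0"
      then show "\<exists>D. (g has_real_derivative D) (at t) \<and> D \<le> 0"
        using der[of t] der_le[of t] assms by (intro exI[of _ "t ^ 3 / (1 + t)"]) auto
    qed (use False in simp)
  qed
  then have "ln (1 + y) \<le> y - y\<^sup>2 / 2 + y ^ 3 / 3" by (simp add: g_def)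
  then have "(1 + y) * ln (1 + y) \<le> (1 + y) * (y - y\<^sup>2 / 2 + y ^ 3 / 3)"
    using assms by (intro mult_left_mono) auto
  also have "\<dots> = y + y\<^sup>2 / 2 + (- (y ^ 3) / 6 + y ^ 4 / 3)"
    by (simp add: field_simps power2_eq_square power3_eq_cube power4_eq_xxxx)
  also have "- (y ^ 3) / 6 + y ^ 4 / 3 \<le> \<bar>y\<bar> ^ 3"
  proof -
    have "y ^ 4 = \<bar>y\<bar> ^ 3 * \<bar>y\<bar>" by (simp add: power3_eq_cube power4_eq_xxxx abs_mult[symmetric])
    also have "\<dots> \<le> \<bar>y\<bar> ^ 3 * 1" using assms by (intro mult_left_mono) auto
    finally have "y ^ 4 \<le> \<bar>y\<bar> ^ 3" by simp
    moreover have "- (y ^ 3) \<le> \<bar>y\<bar> ^ 3" by (simp add: power_abs[symmetric])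
    moreover have "\<bar>y\<bar> ^ 3 \<ge> 0" by simp
    ultimately show ?thesis by linarith
  qed
  finally show ?thesis by simp
qed

text \<open>The exponent is \<open>- n powr (1/5) / 4\<close>, which beats every power of
  \<open>n\<close>. The shape is that of the tail in \<open>concentration\<close> divided by the
  lower bound in \<open>Nrm_lower\<close>.\<close>

lemma polynomial_times_exp_tendsto_0:
  fixes C L :: real
  assumes "C > 0" "L \<ge> 1"
  shows "(\<lambda>n. (real n)\<^sup>2 * (2 * L * exp (- (real n powr (3 / 5))\<^sup>2 / (4 * real n)) * ((real n + 1) powr L / C)))
    \<longlonglongrightarrow> 0"
  using assms by real_asymp

text \<open>With \<open>2 * ln 2\<close> at least 4/3 and the quadratic Taylor bound for
  \<open>exp\<close>, the difference is at least \<open>2/3 * (x - 1/2)^2 + 1/12\<close>.\<close>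

lemma affine_less_exp:
  fixes x :: real
  assumes "x \<ge> 0" shows "2 * x + 13 / 12 < 2 * ln 2 * exp x"
proof -
  have "1 + x + x\<^sup>2 / 2 \<le> exp x" by (rule exp_lower_Taylor_quadratic[OF assms])
  then have "4 / 3 * (1 + x + x\<^sup>2 / 2) \<le> 2 * ln 2 * exp x"
    using ln2_ge_two_thirds assms by (intro mult_mono add_nonneg_nonneg) auto
  moreover have "0 \<le> (x - 1 / 2)\<^sup>2" by simp
  ultimately show ?thesis by (simp add: power2_eq_square algebra_simps)
qed

section \<open>Exponential tilting and relative entropy\<close>

lemma kl_div_eq_sum_ln:
  fixes R P :: "'a::finite \<Rightarrow> real"
  assumes "\<And>c. R c \<ge> 0"
  shows "kl_div R P = (\<Sum>c\<in>UNIV. R c * ln (R c / P c)) / ln 2"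
proof -
  have "kl_div R P = (\<Sum>c\<in>UNIV. R c * log 2 (R c / P c))"
    unfolding kl_div_def using assms by (intro sum.mono_neutral_left) (auto simp: order.antisym not_less)
  then show ?thesis by (simp add: log_def sum_divide_distrib)
qed

text \<open>The equality case of Gibbs' inequality: adding \<open>P c - R c\<close>, which sums to
  0, makes every summand nonnegative, and zero only where \<open>R c = P c\<close>.\<close>

lemma kl_div_le_0_imp_eq:
  fixes R P :: "'a::finite \<Rightarrow> real"
  assumes R: "\<And>c. R c \<ge> 0" "sum R UNIV = 1" and P: "\<And>c. P c > 0" "sum P UNIV = 1"
    and le: "kl_div R P \<le> 0"
  shows "R = P"
proof -
  define t where "t c = R c * ln (R c / P c) - (R c - P c)" for c
  have t: "t c \<ge> 0" "t c = 0 \<Longrightarrow> R c = P c" for c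
  proof -
    have "t c \<ge> 0 \<and> (t c = 0 \<longrightarrow> R c = P c)"
    proof (cases "R c = 0")
      case True then show ?thesis using P(1)[of c] by (simp add: t_def)
    next
      case False
      then have Rp: "R c > 0" using R(1)[of c] by simp
      have q: "P c / R c > 0" using Rp P(1) by simp
      have "ln (R c / P c) = - ln (P c / R c)" using Rp P(1)[of c] by (simp add: ln_divide_pos)
      then have "t c = R c * ((P c / R c - 1) - ln (P c / R c))"
        using Rp by (simp add: t_def algebra_simps)
      moreover have "ln (P c / R c) \<le> P c / R c - 1" using q by (rule ln_le_minus_one)
      moreover have "ln (P c / R c) = P c / R c - 1 \<Longrightarrow> P c / R c = 1" using q by (intro ln_eq_minus_one)
      ultimately show ?thesis using Rp by auto
    qed
    then show "t c \<ge> 0" "t c = 0 \<Longrightarrow> R c = P c" by auto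
  qed
  have "(\<Sum>c\<in>UNIV. t c) = (\<Sum>c\<in>UNIV. R c * ln (R c / P c))"
    unfolding t_def by (simp add: sum_subtractf R P)
  then have kl: "kl_div R P = (\<Sum>c\<in>UNIV. t c) / ln 2"
    by (simp add: kl_div_eq_sum_ln[OF R(1)])
  have s: "(\<Sum>c\<in>UNIV. t c) \<ge> 0" by (intro sum_nonneg t)
  have "(\<Sum>c\<in>UNIV. t c) \<le> 0" using le by (simp add: kl divide_le_0_iff)
  then have "(\<Sum>c\<in>UNIV. t c) = 0" using s by simp
  then have "t c = 0" for c using t(1) by (simp add: sum_nonneg_eq_0_iff)
  then show "R = P" using t(2) by auto
qed

text \<open>A Pythagorean identity. Since \<open>ln (P c / Q c)\<close> is affine in
  \<open>f c\<close>, the cross term depends on \<open>R\<close> only through its mean. It serves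
  both to identify the minimiser and to split the excess divergence.\<close>

lemma tilted_kl_div_diff:
  fixes P Q R f :: "'a::finite \<Rightarrow> real"
  assumes Q: "\<And>c. Q c > 0" and Z: "Z > 0"
    and P: "\<And>c. Q c = P c * (Z * exp (\<theta> * f c))" "sum P UNIV = 1"
    and R: "\<And>c. R c \<ge> 0" "sum R UNIV = 1"
  shows "kl_div R Q - kl_div P Q = kl_div R P + \<theta> * (expect f P - expect f R) / ln 2"
proof -
  have Pp: "P c > 0" for c
    using P(1)[of c] Q[of c] Z zero_less_mult_pos2[of "P c" "Z * exp (\<theta> * f c)"] by simp
  have eq: "kl_div S Q = kl_div S P - (ln Z + \<theta> * expect f S) / ln 2"
    if S: "\<And>c. S c \<ge> 0" "sum S UNIV = 1" for S
  proof -
    have "S c * ln (S c / Q c) = S c * ln (S c / P c) - (S c * ln Z + \<theta> * (S c * f c))" for c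
    proof (cases "S c = 0")
      case False
      then have "S c > 0" using S(1)[of c] by simp
      then have "ln (S c / Q c) = ln (S c / P c) - (ln Z + \<theta> * f c)"
        using Pp[of c] Q[of c] Z by (simp add: P(1)[of c] ln_divide_pos ln_mult_pos)
      then show ?thesis by (simp only: distrib_left right_diff_distrib) (simp add: mult_ac)
    qed simp
    then have "(\<Sum>c\<in>UNIV. S c * ln (S c / Q c)) = (\<Sum>c\<in>UNIV. S c * ln (S c / P c)) - (ln Z + \<theta> * expect f S)"
      using S(2) by (simp add: sum_subtractf sum.distrib expect_def flip: sum_distrib_left sum_distrib_right)
    then show ?thesis by (simp add: kl_div_eq_sum_ln S diff_divide_distrib)
  qed
  have "kl_div P P = 0" using Pp[THEN less_imp_neq] by (simp add: kl_div_def)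
  then have "kl_div P Q = - ((ln Z + \<theta> * expect f P) / ln 2)" using eq[of P] Pp P(2) by (simp add: less_imp_le)
  then show ?thesis using eq[OF R] by (simp add: add_divide_distrib diff_divide_distrib algebra_simps)
qed

text \<open>The intermediate value theorem in the tilting parameter: the centred moment is positive
  at 0, and for large parameters only the minimisers of \<open>f\<close> retain weight, which makes
  it negative.\<close>

lemma exists_tilting:
  fixes Q f :: "'a::finite \<Rightarrow> real"
  assumes Q: "\<And>c. Q c > 0" "sum Q UNIV = 1" and lo: "Min (range f) < I" and hi: "I < expect f Q"
  obtains P \<theta> Z where "\<theta> > 0" "Z > 0" "\<And>c. P c > 0" "\<And>c. Q c = P c * (Z * exp (\<theta> * f c))"
    "sum P UNIV = 1" "(\<Sum>c\<in>UNIV. P c * f c) = I"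
proof -
  define m where "m = Min (range f)"
  have m_le: "m \<le> f c" for c by (simp add: m_def)
  have "m \<in> range f" unfolding m_def by (intro Min_in) auto
  then obtain c0 where c0: "f c0 = m" by auto
  \<comment> \<open>Subtracting \<open>m\<close> in the exponent rescales the moment by
    \<open>exp (t * m)\<close>, so that its zeros are unchanged and a finite limit exists.\<close>
  define g where "g t = (\<Sum>c\<in>UNIV. Q c * exp (- t * (f c - m)) * (f c - I))" for t :: real
  have g0: "g 0 > 0"
  proof -
    have "g 0 = expect f Q - I"
      by (simp add: g_def expect_def right_diff_distrib sum_subtractf Q(2) flip: sum_distrib_right)
    then show ?thesis using hi by simp
  qed
  have "((\<lambda>t. \<Sum>c\<in>UNIV. Q c * exp (- t * (f c - m)) * (f c - I)) \<longlongrightarrow> (\<Sum>c\<in>UNIV. Q c * of_bool (f c = m) * (f c - I))) at_top"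
  proof (intro tendsto_sum tendsto_mult tendsto_const)
    fix c
    show "((\<lambda>t. exp (- t * (f c - m))) \<longlongrightarrow> of_bool (f c = m)) at_top"
    proof (cases "f c = m")
      case False
      then have "f c - m > 0" using m_le[of c] by simp
      then have "((\<lambda>t. exp (- t * (f c - m))) \<longlongrightarrow> 0) at_top" by real_asymp
      then show ?thesis using False by simp
    qed simp
  qed
  then have lim: "(g \<longlongrightarrow> (\<Sum>c\<in>UNIV. Q c * of_bool (f c = m) * (f c - I))) at_top"
    by (simp add: g_def[abs_def])
  have "(\<Sum>c\<in>UNIV. Q c * of_bool (f c = m) * (f c - I)) < (\<Sum>c\<in>(UNIV::'a set). 0)"
  proof (rule sum_strict_mono_ex1)
    show "\<forall>c\<in>UNIV. Q c * of_bool (f c = m) * (f c - I) \<le> 0"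
      using Q(1) lo by (auto simp: m_def less_imp_le intro!: mult_nonneg_nonpos)
    show "\<exists>c\<in>UNIV. Q c * of_bool (f c = m) * (f c - I) < 0"
      using Q(1)[of c0] lo c0 by (intro bexI[of _ c0]) (auto simp: m_def mult_pos_neg)
  qed simp
  then have "\<forall>\<^sub>F t in at_top. g t < 0 \<and> t \<ge> 0"
    using order_tendstoD(2)[OF lim, of 0] by (intro eventually_conj eventually_ge_at_top) simp
  then obtain t where t: "g t < 0" "t \<ge> 0"
    unfolding eventually_at_top_linorder by blast
  have "\<exists>\<theta>\<ge>0. \<theta> \<le> t \<and> g \<theta> = 0"
    by (rule IVT2) (use t g0 in \<open>auto simp: g_def intro!: continuous_intros\<close>)
  then obtain \<theta> where \<theta>: "\<theta> \<ge> 0" "g \<theta> = 0" by blast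
  then have th: "\<theta> > 0" using g0 by (cases "\<theta> = 0") auto
  define Z where "Z = (\<Sum>c\<in>UNIV. Q c * exp (- \<theta> * f c))"
  have Z: "Z > 0" unfolding Z_def using Q(1) by (intro sum_pos) auto
  define P where "P c = Q c * exp (- \<theta> * f c) / Z" for c
  show ?thesis
  proof
    show "\<theta> > 0" "Z > 0" by fact+
    show "P c > 0" for c using Q(1) Z by (simp add: P_def)
    show "Q c = P c * (Z * exp (\<theta> * f c))" for c
      using Z by (simp add: P_def exp_minus)
    show "sum P UNIV = 1" using Z by (simp add: P_def Z_def flip: sum_divide_distrib)
    have "g \<theta> = (\<Sum>c\<in>UNIV. exp (\<theta> * m) * Z * (P c * f c - I * P c))"
      unfolding g_def using Z
      by (intro sum.cong refl) (simp add: P_def right_diff_distrib exp_diff exp_minus field_simps)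
    also have "\<dots> = exp (\<theta> * m) * Z * ((\<Sum>c\<in>UNIV. P c * f c) - I)"
      using \<open>sum P UNIV = 1\<close> by (simp add: sum_subtractf flip: sum_distrib_left)
    finally show "(\<Sum>c\<in>UNIV. P c * f c) = I" using \<theta>(2) Z by simp
  qed
qed

section \<open>The conditioned law of the letter counts\<close>

text \<open>\<open>L\<close> is the alphabet size; it is a parameter only because a constant defined from
  \<open>CARD('a)\<close> alone would acquire a type argument.\<close>

locale tilted =
  fixes P f :: "'a::finite \<Rightarrow> real" and I \<theta> \<kappa> L :: real and a b :: 'a
  assumes \<kappa>_pos: "\<kappa> > 0" and \<kappa>_le: "\<And>c. \<kappa> \<le> P c"
    and P_sum: "sum P UNIV = 1" and P_mean: "(\<Sum>c\<in>UNIV. P c * f c) = I"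
    and \<theta>_pos: "\<theta> > 0" and ab: "f a < f b"
    and L_card: "L = real CARD('a)"
begin

definition "d = f b - f a"
definition "X = \<theta> * d"
definition "F = (\<Sum>c\<in>UNIV. \<bar>I - f c\<bar>)"

text \<open>For letter counts \<open>N\<close> with total \<open>n\<close>, \<open>slack N = n I - \<Sum> N f\<close>; \<open>gap\<close> extends this
  linearly to arbitrary vectors, in particular to shifts with total \<open>0\<close>.\<close>

definition gap :: "('a \<Rightarrow> real) \<Rightarrow> real" where "gap z = (\<Sum>c\<in>UNIV. z c * (I - f c))"
abbreviation slack :: "('a \<Rightarrow> nat) \<Rightarrow> real" where "slack N \<equiv> gap (\<lambda>c. real (N c))"

definition feas :: "nat \<Rightarrow> ('a \<Rightarrow> nat) set" where "feas n = {N \<in> types n. slack N \<ge> 0}"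
text \<open>On \<open>types n\<close> this is \<open>mass Q N\<close> up to a factor depending only
  on \<open>n\<close>, as \<open>mean_type_eq_mtype\<close> shows.\<close>

definition wt :: "('a \<Rightarrow> nat) \<Rightarrow> real" where "wt N = mass P N * exp (- \<theta> * slack N)"
definition Nrm :: "nat \<Rightarrow> real" where "Nrm n = (\<Sum>N\<in>feas n. wt N)"
text \<open>Division by zero makes this 0 when \<open>Nrm n = 0\<close>, so linearity and
  monotonicity hold for all \<open>n\<close>, and only constants require
  \<open>Nrm n > 0\<close>.\<close>

definition avg :: "nat \<Rightarrow> (('a \<Rightarrow> nat) \<Rightarrow> real) \<Rightarrow> real" where
  "avg n G = (\<Sum>N\<in>feas n. wt N * G N) / Nrm n"

definition near :: "nat \<Rightarrow> real \<Rightarrow> ('a \<Rightarrow> nat) \<Rightarrow> bool" where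
  "near n h N \<longleftrightarrow> (\<forall>c. \<bar>real (N c) - n * P c\<bar> \<le> h)"
text \<open>Half of Pearson's chi-square statistic, the exponent of the local Gaussian
  approximation.\<close>

definition quad :: "nat \<Rightarrow> ('a \<Rightarrow> nat) \<Rightarrow> real" where
  "quad n N = (\<Sum>c\<in>UNIV. (real (N c) - n * P c)\<^sup>2 / (2 * (n * P c)))"
text \<open>The error of \<open>ln_fact_diff\<close> for two counts at distance at most
  \<open>2 * h\<close>, with \<open>m\<close> at least \<open>n * \<kappa>\<close>, summed over the
  \<open>L\<close> letters.\<close>

definition err :: "nat \<Rightarrow> real \<Rightarrow> real" where
  "err n h = L * (2 * h * (2 * h\<^sup>2 / (n * \<kappa>)\<^sup>2 + 1 / (2 * (n * \<kappa>))))"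
definition bad :: "nat \<Rightarrow> real \<Rightarrow> real" where
  "bad n h = avg n (\<lambda>N. of_bool (\<not> near n h N))"

section \<open>Properties of the gap functional and of averages, and mass ratios inside a
  window\<close>

lemma d_pos: "d > 0" using ab by (simp add: d_def)
lemma X_pos: "X > 0" using d_pos \<theta>_pos by (simp add: X_def)
lemma P_pos: "P c > 0" using \<kappa>_pos \<kappa>_le[of c] by linarith
lemma P_le_1: "P c \<le> 1"
  using member_le_sum[of c UNIV P] P_pos P_sum by (simp add: less_imp_le)
lemma L_ge_1: "L \<ge> 1" using L_card zero_less_card_finite[where 'a='a] by linarith

lemma gap_add: "gap (\<lambda>c. x c + y c) = gap x + gap y"
  by (simp add: gap_def sum.distrib distrib_right)
lemma gap_diff: "gap (\<lambda>c. x c - y c) = gap x - gap y"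
  by (simp add: gap_def sum_subtractf left_diff_distrib)
lemma gap_scale: "gap (\<lambda>c. k * x c) = k * gap x"
  by (simp add: gap_def sum_distrib_left mult.assoc)
lemma gap_P: "gap P = 0"
  using P_mean P_sum by (simp add: gap_def right_diff_distrib sum_subtractf flip: sum_distrib_right)

lemma gap_bound:
  assumes "\<And>c. \<bar>z c\<bar> \<le> C" shows "\<bar>gap z\<bar> \<le> C * F"
proof -
  have "\<bar>gap z\<bar> \<le> (\<Sum>c\<in>UNIV. \<bar>z c * (I - f c)\<bar>)" unfolding gap_def by (rule sum_abs)
  also have "\<dots> \<le> (\<Sum>c\<in>UNIV. C * \<bar>I - f c\<bar>)"
    using assms by (intro sum_mono) (simp add: abs_mult mult_right_mono)
  finally show ?thesis by (simp add: F_def sum_distrib_left)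
qed

lemma finite_feas [simp]: "finite (feas n)"
  unfolding feas_def by simp

lemma wt_pos: "wt N > 0"
  unfolding wt_def by (simp add: mass_pos P_pos)

lemma sum_wt_nonneg: "(\<And>N. N \<in> S \<Longrightarrow> G N \<ge> 0) \<Longrightarrow> (\<Sum>N\<in>S. wt N * G N) \<ge> 0"
  using wt_pos by (intro sum_nonneg mult_nonneg_nonneg) (auto simp: less_imp_le)

lemma Nrm_nonneg: "Nrm n \<ge> 0"
  using sum_wt_nonneg[of "feas n" "\<lambda>_. 1"] by (simp add: Nrm_def)

lemma avg_add: "avg n (\<lambda>N. G N + H N) = avg n G + avg n H"
  by (simp add: avg_def sum.distrib distrib_left add_divide_distrib)
lemma avg_diff: "avg n (\<lambda>N. G N - H N) = avg n G - avg n H"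
  by (simp add: avg_def sum_subtractf right_diff_distrib diff_divide_distrib)
lemma avg_scale: "avg n (\<lambda>N. k * G N) = k * avg n G"
proof -
  have "(\<Sum>N\<in>feas n. wt N * (k * G N)) = k * (\<Sum>N\<in>feas n. wt N * G N)"
    unfolding sum_distrib_left by (intro sum.cong) auto
  then show ?thesis by (simp add: avg_def)
qed
lemma avg_sum: "avg n (\<lambda>N. \<Sum>c\<in>S. G c N) = (\<Sum>c\<in>S. avg n (G c))"
  by (simp add: avg_def sum_distrib_left sum_divide_distrib) (rule sum.swap)
lemma avg_const: "Nrm n > 0 \<Longrightarrow> avg n (\<lambda>N. k) = k"
  by (simp add: avg_def Nrm_def flip: sum_distrib_right)
lemma avg_mono: "(\<And>N. N \<in> feas n \<Longrightarrow> G N \<le> H N) \<Longrightarrow> avg n G \<le> avg n H"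
  unfolding avg_def using wt_pos Nrm_nonneg
  by (intro divide_right_mono sum_mono mult_left_mono) (auto simp: less_imp_le)

lemma bad_nonneg: "bad n h \<ge> 0"
  unfolding bad_def avg_def using Nrm_nonneg by (intro divide_nonneg_nonneg sum_wt_nonneg) auto

text \<open>A local limit comparison without Stirling's formula. Expanding around
  \<open>n * P c\<close>, the term \<open>ln (P c)\<close> cancels against the multinomial weight,
  and the remaining \<open>ln n\<close> cancels because both counts have total
  \<open>n\<close>.\<close>

lemma mass_ratio:
  assumes N: "N \<in> types n" "near n h N" and M: "M \<in> types n" "near n h M"
    and n: "n > 0" and h: "h \<le> n * \<kappa> / 2"
  shows "mass P M \<ge> mass P N * exp (quad n N - quad n M - err n h)"
proof -
  have lnm: "ln (mass P K) = ln (fact n) + (\<Sum>c\<in>UNIV. K c * ln (P c) - ln (fact (K c)))"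
    if "K \<in> types n" for K
  proof -
    have "ln (mass P K) = ln (fact n) + ln (\<Prod>c\<in>UNIV. P c ^ K c / fact (K c))"
      using that P_pos unfolding mass_def types_def
      by (simp add: ln_mult_pos prod_pos)
    also have "ln (\<Prod>c\<in>UNIV. P c ^ K c / fact (K c)) = (\<Sum>c\<in>UNIV. ln (P c ^ K c / fact (K c)))"
      by (intro ln_prod) (auto simp: P_pos[THEN less_imp_neq, THEN not_sym])
    also have "\<dots> = (\<Sum>c\<in>UNIV. K c * ln (P c) - ln (fact (K c)))"
      using P_pos by (intro sum.cong refl) (simp add: ln_divide_pos ln_realpow)
    finally show ?thesis .
  qed
  define E where "E = 2 * h * (2 * h\<^sup>2 / (n * \<kappa>)\<^sup>2 + 1 / (2 * (n * \<kappa>)))"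
  have h0: "h \<ge> 0" using N(2) abs_ge_zero order_trans unfolding near_def by blast
  have nk: "n * \<kappa> > 0" using n \<kappa>_pos by simp
  have each: "(real (M c) * ln (P c) - ln (fact (M c))) - (real (N c) * ln (P c) - ln (fact (N c)))
     \<ge> (real (N c) - M c) * ln n + ((real (N c) - n * P c)\<^sup>2 / (2 * (n * P c)) - (real (M c) - n * P c)\<^sup>2 / (2 * (n * P c))) - E"
    for c
  proof -
    define m where "m = n * P c"
    have m: "m > 0" "n * \<kappa> \<le> m" using n P_pos \<kappa>_le by (auto simp: m_def)
    have B: "\<bar>real (N c) - m\<bar> \<le> h" "\<bar>real (M c) - m\<bar> \<le> h"
      using N M by (auto simp: near_def m_def)
    have "\<bar>ln (fact (M c)) - ln (fact (N c))
           - ((real (M c) - real (N c)) * ln m + ((real (M c) - m)\<^sup>2 - (real (N c) - m)\<^sup>2) / (2 * m))\<bar>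
         \<le> \<bar>real (M c) - real (N c)\<bar> * (2 * h\<^sup>2 / m\<^sup>2 + 1 / (2 * m))"
      using m h B by (intro ln_fact_diff) auto
    moreover have mm: "0 < m\<^sup>2 * (n * \<kappa>)\<^sup>2" "0 < 2 * m * (2 * (n * \<kappa>))"
      using mult_pos_pos[OF zero_less_power[OF m(1)] zero_less_power[OF nk]] mult_pos_pos[OF m(1) nk]
      by (blast, linarith)
    moreover have "\<bar>real (M c) - real (N c)\<bar> * (2 * h\<^sup>2 / m\<^sup>2 + 1 / (2 * m)) \<le> E" unfolding E_def
    proof (intro mult_mono add_mono)
      show "\<bar>real (M c) - real (N c)\<bar> \<le> 2 * h" using B by linarith
      show "2 * h\<^sup>2 / m\<^sup>2 \<le> 2 * h\<^sup>2 / (n * \<kappa>)\<^sup>2"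
        using m(2) nk mm(1) by (intro divide_left_mono power_mono) auto
      show "1 / (2 * m) \<le> 1 / (2 * (n * \<kappa>))"
        using m(2) nk mm(2) by (intro divide_left_mono) auto
    qed (use h0 m in auto)
    ultimately have *: "ln (fact (M c)) - ln (fact (N c)) \<le> (real (M c) - real (N c)) * ln m
        + ((real (M c) - m)\<^sup>2 - (real (N c) - m)\<^sup>2) / (2 * m) + E" by linarith
    have "ln m = ln n + ln (P c)" using n P_pos by (simp add: m_def ln_mult_pos)
    then show ?thesis using * unfolding m_def[symmetric]
      by (simp add: algebra_simps diff_divide_distrib)
  qed
  have "ln (mass P M) - ln (mass P N) = (\<Sum>c\<in>UNIV. (real (M c) * ln (P c) - ln (fact (M c))) - (real (N c) * ln (P c) - ln (fact (N c))))"
    by (simp add: lnm N M sum_subtractf)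
  also have "\<dots> \<ge> (\<Sum>c\<in>UNIV. (real (N c) - M c) * ln n + ((real (N c) - n * P c)\<^sup>2 / (2 * (n * P c)) - (real (M c) - n * P c)\<^sup>2 / (2 * (n * P c))) - E)"
    by (intro sum_mono each)
  also have "(\<Sum>c\<in>UNIV. (real (N c) - M c) * ln n + ((real (N c) - n * P c)\<^sup>2 / (2 * (n * P c)) - (real (M c) - n * P c)\<^sup>2 / (2 * (n * P c))) - E)
     = (\<Sum>c\<in>UNIV. real (N c) - M c) * ln n + (quad n N - quad n M) - err n h"
    unfolding quad_def err_def E_def
    by (simp add: sum.distrib sum_subtractf L_card flip: sum_distrib_right)
  also have "(\<Sum>c\<in>UNIV. real (N c) - M c) = 0"
    using N M by (simp add: sum_subtractf types_def flip: of_nat_sum)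
  finally have "ln (mass P N) + (quad n N - quad n M - err n h) \<le> ln (mass P M)" by simp
  then have "exp (ln (mass P N) + (quad n N - quad n M - err n h)) \<le> exp (ln (mass P M))" by simp
  then show ?thesis by (simp add: exp_add mass_pos P_pos)
qed

text \<open>Tilting the single letter \<open>c\<close> turns the left side into an
  \<open>n\<close>-th power by the multinomial theorem; one factor is bounded through
  \<open>exp l \<le> 1 + l + l^2\<close>.\<close>

lemma chernoff:
  assumes "\<bar>l\<bar> \<le> 1"
  shows "(\<Sum>N\<in>types n. mass P N * exp (l * (real (N c) - n * P c))) \<le> exp (n * l\<^sup>2)"
proof -
  define g where "g c' = (if c' = c then exp l else 1)" for c'
  have "(\<Sum>N\<in>types n. mass P N * exp (l * (real (N c) - n * P c)))
     = (\<Sum>N\<in>types n. mass (\<lambda>a. P a * g a) N) * exp (- l * (n * P c))"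
    unfolding sum_distrib_right
  proof (intro sum.cong refl)
    fix N
    have "(\<Prod>a\<in>UNIV. g a ^ N a) = (\<Prod>a\<in>UNIV. if a = c then exp l ^ N a else 1)"
      by (intro prod.cong) (auto simp: g_def)
    then have "(\<Prod>a\<in>UNIV. g a ^ N a) = exp (l * N c)"
      by (simp add: mult.commute[of l] exp_of_nat_mult)
    then show "mass P N * exp (l * (real (N c) - n * P c)) = mass (\<lambda>a. P a * g a) N * exp (- l * (n * P c))"
      by (simp add: mass_scale algebra_simps exp_diff exp_minus divide_inverse)
  qed
  also have "\<dots> = (\<Sum>a\<in>UNIV. P a * g a) ^ n * exp (- l * P c) ^ n"
    by (simp add: sum_mass exp_of_nat_mult[symmetric] mult_ac)
  also have "(\<Sum>a\<in>UNIV. P a * g a) = (\<Sum>a\<in>UNIV. P a + (if a = c then P c * (exp l - 1) else 0))"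
    by (intro sum.cong) (auto simp: g_def algebra_simps)
  also have "\<dots> = 1 + P c * (exp l - 1)" by (simp add: sum.distrib P_sum)
  also have "(1 + P c * (exp l - 1)) ^ n * exp (- l * P c) ^ n \<le> exp (P c * l\<^sup>2 + l * P c) ^ n * exp (- l * P c) ^ n"
  proof (intro mult_right_mono power_mono)
    have "exp l \<le> 1 + l + l\<^sup>2"
    proof (cases "l \<ge> 0")
      case True then show ?thesis using exp_bound[of l] assms by simp
    next
      case False
      \<comment> \<open>For negative \<open>l\<close> one takes reciprocals and uses
        \<open>(1 + l + l^2) * (1 - l) = 1 - l^3\<close>, which is at least 1.\<close>
      have "1 + (-l) \<le> exp (- l)" by (rule exp_ge_add_one_self)
      then have "exp l \<le> 1 / (1 - l)" using False
        by (simp add: exp_minus field_simps)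
      also have "\<dots> \<le> 1 + l + l\<^sup>2"
      proof -
        have "(1 + l + l\<^sup>2) * (1 - l) = 1 - l * l\<^sup>2" by (simp add: algebra_simps power2_eq_square)
        moreover have "l * l\<^sup>2 \<le> 0" using False by (intro mult_nonpos_nonneg) auto
        ultimately show ?thesis using False by (subst pos_divide_le_eq) auto
      qed
      finally show ?thesis .
    qed
    then have "P c * (exp l - 1) \<le> P c * (l + l\<^sup>2)" using P_pos[of c] by (intro mult_left_mono) auto
    moreover have "1 + (P c * l\<^sup>2 + l * P c) \<le> exp (P c * l\<^sup>2 + l * P c)" by (rule exp_ge_add_one_self)
    ultimately show "1 + P c * (exp l - 1) \<le> exp (P c * l\<^sup>2 + l * P c)"
      by (simp only: distrib_left mult.commute[of l])
    have "0 \<le> (1 - P c) + P c * exp l"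
      using P_pos[of c] P_le_1[of c] by (intro add_nonneg_nonneg mult_nonneg_nonneg) auto
    then show "0 \<le> 1 + P c * (exp l - 1)" by (simp add: algebra_simps)
  qed auto
  also have "\<dots> = exp (n * (P c * l\<^sup>2))"
    by (simp add: exp_of_nat_mult flip: power_mult_distrib exp_add)
  also have "\<dots> \<le> exp (n * l\<^sup>2)"
    using P_le_1[of c] by (simp add: mult_left_mono mult_left_le_one_le P_pos less_imp_le)
  finally show ?thesis .
qed

text \<open>A union bound over the letters and the two signs of the deviation, which accounts for
  the factor \<open>2 * L\<close>.\<close>

lemma concentration:
  assumes h: "0 \<le> h" "h \<le> 2 * n" and n: "n > 0"
  shows "(\<Sum>N | N \<in> types n \<and> \<not> near n h N. mass P N) \<le> 2 * L * exp (- h\<^sup>2 / (4 * real n))"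
proof -
  \<comment> \<open>The minimiser of \<open>n * l^2 - l * h\<close>; the assumption
    \<open>h \<le> 2 * n\<close> keeps it within the range of \<open>chernoff\<close>.\<close>
  define l where "l = h / (2 * n)"
  have l: "\<bar>l\<bar> \<le> 1" "\<bar>- l\<bar> \<le> 1" "0 \<le> l" using h n by (auto simp: l_def field_simps)
  have m0: "mass P N \<ge> 0" for N using mass_pos[of P N] P_pos by (simp add: less_imp_le)
  let ?E = "\<lambda>c N. exp (l * (real (N c) - n * P c)) + exp (- l * (real (N c) - n * P c))"
  have abs_exp: "exp (l * \<bar>x\<bar>) \<le> exp (l * x) + exp (- l * x)" for x
    by (cases "x \<ge> 0") (auto simp: add_increasing add_increasing2)
  have key: "exp (l * h) \<le> (\<Sum>c\<in>UNIV. ?E c N)" if bd: "\<not> near n h N" for N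
  proof -
    obtain c where c: "\<bar>real (N c) - n * P c\<bar> > h" using bd by (auto simp: near_def not_le)
    have "l * h \<le> l * \<bar>real (N c) - n * P c\<bar>" using c l by (intro mult_left_mono) auto
    then have "exp (l * h) \<le> exp (l * \<bar>real (N c) - n * P c\<bar>)" by simp
    also have "\<dots> \<le> ?E c N" by (rule abs_exp)
    also have "\<dots> \<le> (\<Sum>c\<in>UNIV. ?E c N)"
      by (rule member_le_sum[where f = "\<lambda>c. ?E c N"]) (auto simp: add_nonneg_nonneg)
    finally show ?thesis .
  qed
  have "exp (l * h) * (\<Sum>N | N \<in> types n \<and> \<not> near n h N. mass P N)
     \<le> (\<Sum>N | N \<in> types n \<and> \<not> near n h N. mass P N * (\<Sum>c\<in>UNIV. ?E c N))"
    unfolding mult.commute[of "exp (l * h)"] sum_distrib_right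
    using key m0 by (intro sum_mono mult_left_mono) auto
  also have "\<dots> \<le> (\<Sum>N\<in>types n. mass P N * (\<Sum>c\<in>UNIV. ?E c N))"
    using m0 by (intro sum_mono2) (auto intro!: mult_nonneg_nonneg sum_nonneg add_nonneg_nonneg)
  also have "\<dots> = (\<Sum>c\<in>UNIV. (\<Sum>N\<in>types n. mass P N * exp (l * (real (N c) - n * P c)))
        + (\<Sum>N\<in>types n. mass P N * exp (- l * (real (N c) - n * P c))))"
    unfolding sum_distrib_left by (subst sum.swap) (simp add: sum.distrib distrib_left)
  also have "\<dots> \<le> (\<Sum>c\<in>(UNIV::'a set). exp (n * l\<^sup>2) + exp (n * (- l)\<^sup>2))"
    by (intro sum_mono add_mono chernoff l)
  also have "\<dots> = 2 * L * exp (n * l\<^sup>2)" by (simp add: L_card)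
  finally have "(\<Sum>N | N \<in> types n \<and> \<not> near n h N. mass P N) \<le> 2 * L * (exp (n * l\<^sup>2) / exp (l * h))"
    by (simp add: field_simps)
  also have "exp (n * l\<^sup>2) / exp (l * h) = exp (n * l\<^sup>2 - l * h)" by (simp add: exp_diff)
  also have "n * l\<^sup>2 - l * h = - h\<^sup>2 / (4 * real n)"
    using n by (simp add: l_def field_simps power2_eq_square)
  finally show ?thesis .
qed

text \<open>Rounding down and correcting the total perturbs \<open>gap\<close> by a bounded amount; a bounded multiple
  of the exchange of \<open>b\<close> for \<open>a\<close>, which has \<open>gap = d\<close>, then moves \<open>gap\<close> into \<open>[0, d]\<close>.\<close>

lemma integer_rounding:
  "\<exists>C\<ge>0. \<forall>(z::'a \<Rightarrow> real) (k::int). sum z UNIV = k \<longrightarrow> \<bar>gap z\<bar> \<le> K \<longrightarrow>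
     (\<exists>v::'a \<Rightarrow> int. sum v UNIV = k \<and> 0 \<le> gap (\<lambda>c. real_of_int (v c)) \<and> gap (\<lambda>c. real_of_int (v c)) \<le> d
        \<and> (\<forall>c. \<bar>v c - z c\<bar> \<le> C))"
proof -
  \<comment> \<open>Bounds the number of exchanges: the gap after rounding divided by
    \<open>d\<close>, plus 1 for the floor.\<close>
  define D where "D = (K + (L + 1) * F) / d + 1"
  define C where "C = L + 1 + \<bar>D\<bar>"
  have "\<exists>v::'a \<Rightarrow> int. sum v UNIV = k \<and> 0 \<le> gap (\<lambda>c. real_of_int (v c)) \<and> gap (\<lambda>c. real_of_int (v c)) \<le> d
        \<and> (\<forall>c. \<bar>v c - z c\<bar> \<le> C)" if zk: "sum z UNIV = k" and K: "\<bar>gap z\<bar> \<le> K" for z :: "'a \<Rightarrow> real" and k :: int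
  proof -
    \<comment> \<open>The total lost by the floors, between 0 and \<open>L\<close>, is returned to
      the letter \<open>a\<close>.\<close>
    define r where "r = k - (\<Sum>c\<in>UNIV. \<lfloor>z c\<rfloor>)"
    have "real_of_int r = (\<Sum>c\<in>UNIV. z c - \<lfloor>z c\<rfloor>)" by (simp add: r_def zk sum_subtractf)
    moreover have "(\<Sum>c\<in>UNIV. z c - \<lfloor>z c\<rfloor>) \<le> (\<Sum>c\<in>(UNIV::'a set). 1)"
      by (intro sum_mono) linarith
    moreover have "0 \<le> (\<Sum>c\<in>UNIV. z c - \<lfloor>z c\<rfloor>)" by (intro sum_nonneg) linarith
    ultimately have r: "0 \<le> r" "real_of_int r \<le> L" by (auto simp: L_card)
    define v where "v c = \<lfloor>z c\<rfloor> + (if c = a then r else 0)" for c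
    have sv: "sum v UNIV = k" by (simp add: v_def sum.distrib r_def)
    have vz: "\<bar>v c - z c\<bar> \<le> L + 1" for c
    proof -
      have "of_int \<lfloor>z c\<rfloor> \<le> z c" "z c < of_int \<lfloor>z c\<rfloor> + 1" by linarith+
      moreover have "0 \<le> real_of_int r" using r by simp
      ultimately show ?thesis using r L_ge_1 unfolding v_def abs_le_iff
        by (cases "c = a") (simp_all, linarith+)
    qed
    let ?g = "gap (\<lambda>c. real_of_int (v c))"
    have "\<bar>gap (\<lambda>c. real_of_int (v c) - z c)\<bar> \<le> (L + 1) * F" by (rule gap_bound[OF vz])
    then have g: "\<bar>?g\<bar> \<le> K + (L + 1) * F" using K by (simp add: gap_diff)
    \<comment> \<open>Removing \<open>j\<close> exchanges leaves the remainder of the gap modulo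
      \<open>d\<close>.\<close>
    define j where "j = \<lfloor>?g / d\<rfloor>"
    have j1: "j * d \<le> ?g" "?g \<le> j * d + d"
      using d_pos floor_divide_lower[of d ?g] floor_divide_upper[of d ?g]
      by (auto simp: j_def algebra_simps)
    have "\<bar>?g / d\<bar> \<le> (K + (L + 1) * F) / d" using g d_pos by (simp add: abs_divide divide_right_mono)
    then have jD: "\<bar>real_of_int j\<bar> \<le> D" unfolding D_def j_def by linarith
    define e where "e c = (if c = a then 1 else 0) - (if c = b then 1 else 0 :: int)" for c
    have ge: "gap (\<lambda>c. real_of_int (e c)) = d"
    proof -
      have "gap (\<lambda>c. real_of_int (e c)) = (\<Sum>c\<in>UNIV. (if c = a then I - f c else 0) - (if c = b then I - f c else 0))"
        unfolding gap_def by (intro sum.cong) (auto simp: e_def)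
      then show ?thesis by (simp add: sum_subtractf d_def)
    qed
    have se: "sum e UNIV = 0" unfolding e_def by (simp add: sum_subtractf)
    let ?w = "\<lambda>c. v c - j * e c"
    have "sum ?w UNIV = k" by (simp add: sum_subtractf sv se flip: sum_distrib_left)
    moreover have "gap (\<lambda>c. real_of_int (?w c)) = ?g - j * d"
      by (simp add: gap_diff gap_scale ge)
    moreover have "\<bar>?w c - z c\<bar> \<le> C" for c
    proof -
      have "\<bar>real_of_int (j * e c)\<bar> \<le> \<bar>D\<bar>"
        using jD by (auto simp: e_def abs_mult)
      then show ?thesis using vz[of c] unfolding C_def by simp
    qed
    ultimately show ?thesis using j1 by (intro exI[of _ ?w]) auto
  qed
  moreover have "C \<ge> 0" using L_ge_1 by (simp add: C_def)
  ultimately show ?thesis by blast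
qed

section \<open>Asymptotics\<close>

text \<open>The exponent lies in \<open>(1/2, 2/3)\<close>: above \<open>1/2\<close> the tails \<open>exp (- h\<^sup>2 / 4n)\<close> beat every power of
  \<open>n\<close>, below \<open>2/3\<close> the error \<open>err \<approx> h\<^sup>3 / n\<^sup>2\<close> vanishes.\<close>

definition "h n = real n powr (3 / 5)"

lemma h_nonneg: "h n \<ge> 0" by (simp add: h_def)

lemma near_mono: "near n x N \<Longrightarrow> x \<le> y \<Longrightarrow> near n y N"
  unfolding near_def by (meson order_trans)

text \<open>The factor 3 arises because counts within \<open>h n\<close> are moved by up to
  \<open>2 * h n\<close> and compared in the window of radius \<open>3 * h n\<close>.
  \<open>B\<close> stands for the constants of the individual uses.\<close>

lemma eventually_h:
  "\<forall>\<^sub>F n in sequentially. n > 0 \<and> 3 * h n \<le> n * \<kappa> / 2 \<and> h n \<le> n \<and> B \<le> h n \<and> B \<le> n * \<kappa>"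
  unfolding h_def
  by (intro eventually_conj eventually_gt_at_top) (use \<kappa>_pos in real_asymp)+

lemma err_tendsto: "(\<lambda>n. err n (3 * h n)) \<longlonglongrightarrow> 0"
  unfolding h_def err_def using \<kappa>_pos L_ge_1 by real_asymp

lemma err_nonneg: "x \<ge> 0 \<Longrightarrow> err n x \<ge> 0"
  unfolding err_def using \<kappa>_pos L_ge_1 by simp

text \<open>By pigeonhole some count in the window has probability at least \<open>1 / (4 (n + 1)\<^sup>L)\<close>, and a rounding
  of \<open>n P\<close> to a feasible count is at least as likely up to a constant factor.\<close>

lemma Nrm_lower:
  "\<exists>C>0. \<forall>\<^sub>F n in sequentially. Nrm n \<ge> C / (real n + 1) ^ CARD('a)"
proof -
  obtain C where C: "C \<ge> 0" and round: "\<And>(z::'a \<Rightarrow> real) (k::int). sum z UNIV = k \<Longrightarrow> \<bar>gap z\<bar> \<le> 0 \<Longrightarrow>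
     (\<exists>v::'a \<Rightarrow> int. sum v UNIV = k \<and> 0 \<le> gap (\<lambda>c. real_of_int (v c)) \<and> gap (\<lambda>c. real_of_int (v c)) \<le> d
        \<and> (\<forall>c. \<bar>v c - z c\<bar> \<le> C))"
    using integer_rounding[of 0] by meson
  have e1: "\<forall>\<^sub>F n in sequentially. err n (3 * h n) \<le> 1"
    using tendsto_le_eventually[OF err_tendsto] by simp
  have e2: "\<forall>\<^sub>F n in sequentially. L * (C\<^sup>2 / (2 * (real n * \<kappa>))) \<le> 1"
    using L_ge_1 C \<kappa>_pos by real_asymp
  have e3: "\<forall>\<^sub>F n in sequentially. 2 * L * exp (- (h n)\<^sup>2 / (4 * real n)) \<le> 1 / 2"
    unfolding h_def using L_ge_1 by real_asymp
  have "\<forall>\<^sub>F n in sequentially. Nrm n \<ge> (exp (- 2 - X) / 4) / (real n + 1) ^ CARD('a)"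
    using eventually_h[of C] e1 e2 e3
  proof eventually_elim
    case (elim n)
    \<comment> \<open>If all counts in the window had mass at most \<open>y\<close>, they would
      carry at most 1/4 in total and the tail at most 1/2, short of 1.\<close>
    define y where "y = 1 / (4 * (real n + 1) ^ CARD('a))"
    have n: "n > 0" using elim by simp
    have "sum (\<lambda>c. real n * P c) UNIV = real_of_int (int n)"
      using P_sum by (simp flip: sum_distrib_left)
    moreover have "\<bar>gap (\<lambda>c. real n * P c)\<bar> \<le> 0" by (simp add: gap_scale gap_P)
    ultimately obtain v :: "'a \<Rightarrow> int" where v: "sum v UNIV = int n" "0 \<le> gap (\<lambda>c. real_of_int (v c))"
       "gap (\<lambda>c. real_of_int (v c)) \<le> d" "\<And>c. \<bar>v c - real n * P c\<bar> \<le> C"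
      using round by meson
    have v0: "v c \<ge> 0" for c
    proof -
      have "n * \<kappa> \<le> n * P c" using \<kappa>_le by (simp add: mult_left_mono)
      then have "real_of_int (v c) \<ge> 0" using v(4)[of c] elim by linarith
      then show ?thesis by simp
    qed
    define N where "N c = nat (v c)" for c
    have Nv: "real (N c) = v c" for c using v0 by (simp add: N_def)
    have "int (sum N UNIV) = int n" using v(1) v0 by (simp add: N_def)
    then have N: "N \<in> types n" by (simp only: of_nat_eq_iff types_def mem_Collect_eq)
    have sN: "0 \<le> slack N" "slack N \<le> d" using v by (simp_all add: Nv)
    have "\<bar>real (N c) - real n * P c\<bar> \<le> 3 * h n" for c
      using v(4)[of c] elim h_nonneg[of n] unfolding Nv by linarith
    then have nearN: "near n (3 * h n) N" by (simp add: near_def)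
    have m0: "mass P K \<ge> 0" for K using mass_pos[of P K] P_pos by (simp add: less_imp_le)
    have "\<exists>M. M \<in> types n \<and> near n (h n) M \<and> mass P M > y"
    proof (rule ccontr)
      assume "\<not> ?thesis"
      then have small: "mass P M \<le> y" if "M \<in> types n \<and> near n (h n) M" for M
        using that by force
      have "1 = (\<Sum>M\<in>types n. mass P M)" by (simp add: sum_mass P_sum)
      also have "types n = {M \<in> types n. near n (h n) M} \<union> {M. M \<in> types n \<and> \<not> near n (h n) M}" by auto
      also have "(\<Sum>M\<in>\<dots>. mass P M) = (\<Sum>M | M \<in> types n \<and> near n (h n) M. mass P M)
           + (\<Sum>M | M \<in> types n \<and> \<not> near n (h n) M. mass P M)"
        by (rule sum.union_disjoint) auto
      also have "(\<Sum>M | M \<in> types n \<and> near n (h n) M. mass P M)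
           \<le> real (card {M. M \<in> types n \<and> near n (h n) M}) * y"
        by (rule sum_bounded_above) (use small in auto)
      also have "\<dots> \<le> (real n + 1) ^ CARD('a) * y"
      proof -
        have "card {M::'a \<Rightarrow> nat. M \<in> types n \<and> near n (h n) M} \<le> card (types n :: ('a \<Rightarrow> nat) set)"
          by (rule card_mono) auto
        also have "\<dots> \<le> (n + 1) ^ CARD('a)" by (rule card_types_le)
        finally have "real (card {M::'a \<Rightarrow> nat. M \<in> types n \<and> near n (h n) M}) \<le> real ((n + 1) ^ CARD('a))"
          by (simp only: of_nat_le_iff)
        then show ?thesis by (intro mult_right_mono) (simp_all add: y_def add.commute)
      qed
      also have "\<dots> = 1 / 4" by (simp add: y_def)
      also have "(\<Sum>M | M \<in> types n \<and> \<not> near n (h n) M. mass P M) \<le> 1 / 2"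
        using concentration[of "h n" n] elim h_nonneg[of n] by linarith
      finally show False by simp
    qed
    then obtain M where M: "M \<in> types n" "near n (h n) M" "mass P M > y" by blast
    have "near n (3 * h n) M" by (rule near_mono[OF M(2)]) (simp add: h_nonneg)
    then have "mass P N \<ge> mass P M * exp (quad n M - quad n N - err n (3 * h n))"
      using M N nearN n elim by (intro mass_ratio) auto
    \<comment> \<open>\<open>quad n M\<close> is nonnegative, while \<open>quad n N\<close> and the
      error are each at most 1.\<close>
    moreover have "exp (quad n M - quad n N - err n (3 * h n)) \<ge> exp (- 2)"
    proof -
      have "quad n M \<ge> 0" unfolding quad_def using P_pos by (intro sum_nonneg) (simp add: less_imp_le)
      moreover have "quad n N \<le> (\<Sum>c\<in>(UNIV::'a set). C\<^sup>2 / (2 * (real n * \<kappa>)))"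
        unfolding quad_def
      proof (intro sum_mono frac_le)
        fix c
        show "(real (N c) - real n * P c)\<^sup>2 \<le> C\<^sup>2"
          using v(4)[of c] C by (simp add: Nv abs_le_square_iff[symmetric])
        show "2 * (real n * \<kappa>) \<le> 2 * (real n * P c)" using \<kappa>_le by (simp add: mult_left_mono)
      qed (use n \<kappa>_pos in auto)
      ultimately show ?thesis using elim by (simp add: L_card)
    qed
    ultimately have "mass P N \<ge> y * exp (- 2)"
      using M(3) m0[of M] by (smt (verit) mult_mono exp_ge_zero)
    moreover have "exp (- \<theta> * slack N) \<ge> exp (- X)"
      using sN \<theta>_pos by (simp add: X_def mult_left_mono)
    ultimately have "wt N \<ge> y * exp (- 2) * exp (- X)"
      unfolding wt_def by (intro mult_mono) (auto simp: y_def m0)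
    moreover have "wt N \<le> Nrm n"
      unfolding Nrm_def using N sN wt_pos
      by (intro member_le_sum) (auto simp: feas_def less_imp_le)
    moreover have "y * exp (- 2) * exp (- X) = (exp (- 2 - X) / 4) / (real n + 1) ^ CARD('a)"
      by (simp add: y_def exp_diff exp_minus field_simps)
    ultimately show ?case by linarith
  qed
  moreover have "exp (- 2 - X) / 4 > 0" by simp
  ultimately show ?thesis by blast
qed

lemma eventually_Nrm_pos: "\<forall>\<^sub>F n in sequentially. Nrm n > 0"
proof -
  obtain C where C: "C > 0" and lb: "\<forall>\<^sub>F n in sequentially. Nrm n \<ge> C / (real n + 1) ^ CARD('a)"
    using Nrm_lower by blast
  have "C / (real n + 1) ^ CARD('a) > 0" for n
    using C by (intro divide_pos_pos zero_less_power) auto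
  with lb show ?thesis by (auto elim!: eventually_mono intro: less_le_trans)
qed

text \<open>On feasible counts \<open>exp (- \<theta> * slack N)\<close> is at most 1, so the weight
  outside the window is at most a multinomial tail, negligible against the polynomial lower bound
  for \<open>Nrm n\<close>.\<close>

lemma bad_tendsto: "(\<lambda>n. (real n)\<^sup>2 * bad n (h n)) \<longlonglongrightarrow> 0"
proof -
  obtain C where C: "C > 0" and lb: "\<forall>\<^sub>F n in sequentially. Nrm n \<ge> C / (real n + 1) ^ CARD('a)"
    using Nrm_lower by blast
  define U where "U n = (real n)\<^sup>2 * (2 * L * exp (- (h n)\<^sup>2 / (4 * real n)) * ((real n + 1) powr L / C))" for n
  have upper: "\<forall>\<^sub>F n in sequentially. (real n)\<^sup>2 * bad n (h n) \<le> U n"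
    using lb eventually_h[of 0]
  proof eventually_elim
    case (elim n)
    have pw: "(real n + 1) ^ CARD('a) = (real n + 1) powr L"
      by (simp add: L_card powr_realpow)
    have pos: "C / (real n + 1) powr L > 0" using C by simp
    have "(\<Sum>N\<in>feas n. wt N * of_bool (\<not> near n (h n) N)) = (\<Sum>N | N \<in> feas n \<and> \<not> near n (h n) N. wt N)"
      by (rule sum.mono_neutral_cong_right) auto
    also have "\<dots> \<le> (\<Sum>N | N \<in> feas n \<and> \<not> near n (h n) N. mass P N)"
      using mass_pos[of P] P_pos \<theta>_pos
      by (intro sum_mono) (auto simp: wt_def feas_def less_imp_le intro!: mult_left_le)
    also have "\<dots> \<le> (\<Sum>N | N \<in> types n \<and> \<not> near n (h n) N. mass P N)"
      using mass_pos[of P] P_pos by (intro sum_mono2) (auto simp: feas_def less_imp_le)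
    also have "\<dots> \<le> 2 * L * exp (- (h n)\<^sup>2 / (4 * real n))"
      using elim h_nonneg[of n] by (intro concentration) auto
    finally have "bad n (h n) \<le> 2 * L * exp (- (h n)\<^sup>2 / (4 * real n)) / (C / (real n + 1) powr L)"
      unfolding bad_def avg_def using elim pos L_ge_1
      by (intro frac_le) (auto simp: pw)
    then show ?case unfolding U_def by (intro mult_left_mono) auto
  qed
  have U0: "U \<longlonglongrightarrow> 0"
    using polynomial_times_exp_tendsto_0[OF C L_ge_1] by (simp add: U_def[abs_def] h_def)
  show ?thesis
    by (rule tendsto_sandwich[OF _ upper tendsto_const U0]) (simp add: bad_nonneg)
qed

lemma n_bad_tendsto: "(\<lambda>n. real n * bad n (h n)) \<longlonglongrightarrow> 0"
proof (rule tendsto_sandwich[OF _ _ tendsto_const bad_tendsto])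
  show "\<forall>\<^sub>F n in sequentially. real n * bad n (h n) \<le> (real n)\<^sup>2 * bad n (h n)"
    using eventually_gt_at_top[of 0]
  proof eventually_elim
    case (elim n)
    then have "real n * 1 \<le> real n * real n" by (intro mult_left_mono) auto
    then show ?case using bad_nonneg by (intro mult_right_mono) (auto simp: power2_eq_square)
  qed
qed (simp add: bad_nonneg)

section \<open>Slack bound and integer translations of letter counts\<close>

lemma slack_le:
  assumes "N \<in> types n" shows "slack N \<le> n * F"
proof -
  have "\<bar>slack N\<bar> \<le> real n * F" by (rule gap_bound) (simp add: types_le[OF assms])
  then show ?thesis by simp
qed

text \<open>\<open>nat\<close> truncates at 0; this is a genuine translation only where
  \<open>int (N c) + v c\<close> is nonnegative, which the next lemma ensures inside the
  window.\<close>

definition shift :: "('a \<Rightarrow> int) \<Rightarrow> ('a \<Rightarrow> nat) \<Rightarrow> 'a \<Rightarrow> nat" where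
  "shift v N c = nat (int (N c) + v c)"

text \<open>Within the window each count is at least \<open>n * \<kappa> - h n\<close>, so lowering
  it by \<open>2 * h n\<close> cannot make it negative. The weight bound is
  \<open>mass_ratio\<close> combined with linearity of the slack.\<close>

lemma shift:
  fixes v :: "'a \<Rightarrow> int"
  assumes N: "N \<in> feas n" "near n (h n) N" and v: "sum v UNIV = 0" "\<And>c. \<bar>real_of_int (v c)\<bar> \<le> 2 * h n"
    and n: "n > 0" "3 * h n \<le> n * \<kappa> / 2"
  shows real_shift: "real (shift v N c) = N c + v c"
    and slack_shift: "slack (shift v N) = slack N + gap (\<lambda>c. real_of_int (v c))"
    and shift_types: "shift v N \<in> types n"
    and near_shift: "near n (3 * h n) (shift v N)"
    and wt_shift: "wt (shift v N) \<ge> wt N * exp (quad n N - quad n (shift v N) - err n (3 * h n)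
        - \<theta> * gap (\<lambda>c. real_of_int (v c)))"
proof -
  have nonneg: "int (N c) + v c \<ge> 0" for c
  proof -
    have "n * \<kappa> \<le> n * P c" using \<kappa>_le by (simp add: mult_left_mono)
    moreover have "\<bar>real (N c) - n * P c\<bar> \<le> h n" using N by (simp add: near_def)
    ultimately have "real (N c) + v c \<ge> 0" using v(2)[of c] n h_nonneg[of n] by linarith
    then show ?thesis by (metis of_int_0_le_iff of_int_add of_int_of_nat_eq)
  qed
  show rs: "real (shift v N c) = N c + v c" for c using nonneg by (simp add: shift_def)
  show sl: "slack (shift v N) = slack N + gap (\<lambda>c. real_of_int (v c))" by (simp add: rs gap_add)
  have "int (sum (shift v N) UNIV) = int (sum N UNIV)"
    using nonneg v(1) by (simp add: shift_def sum.distrib)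
  then show ty: "shift v N \<in> types n"
    using N by (simp only: of_nat_eq_iff types_def feas_def mem_Collect_eq)
  show nr: "near n (3 * h n) (shift v N)"
    unfolding near_def rs
  proof
    fix c
    have "\<bar>real (N c) - real n * P c\<bar> \<le> h n" using N by (simp add: near_def)
    then show "\<bar>real_of_int (int (N c) + v c) - real n * P c\<bar> \<le> 3 * h n" using v(2)[of c] by simp
  qed
  have "near n (3 * h n) N" by (rule near_mono[OF N(2)]) (simp add: h_nonneg)
  then have "mass P (shift v N) \<ge> mass P N * exp (quad n N - quad n (shift v N) - err n (3 * h n))"
    using N n ty nr by (intro mass_ratio) (auto simp: feas_def)
  then have "mass P (shift v N) * exp (- \<theta> * slack (shift v N)) \<ge>
     mass P N * exp (quad n N - quad n (shift v N) - err n (3 * h n)) * exp (- \<theta> * slack (shift v N))"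
    by (intro mult_right_mono) auto
  also have "mass P N * exp (quad n N - quad n (shift v N) - err n (3 * h n)) * exp (- \<theta> * slack (shift v N))
     = wt N * exp (quad n N - quad n (shift v N) - err n (3 * h n) - \<theta> * gap (\<lambda>c. real_of_int (v c)))"
    by (simp add: wt_def sl exp_add exp_diff exp_minus field_simps)
  finally show "wt (shift v N) \<ge> wt N * exp (quad n N - quad n (shift v N) - err n (3 * h n)
        - \<theta> * gap (\<lambda>c. real_of_int (v c)))" by (simp add: wt_def)
qed

lemma inj_on_shift:
  assumes "sum v UNIV = 0" "\<And>c. \<bar>real_of_int (v c)\<bar> \<le> 2 * h n" "n > 0" "3 * h n \<le> n * \<kappa> / 2"
  shows "inj_on (shift v) {N \<in> feas n. near n (h n) N}"
proof (rule inj_onI, rule ext)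
  fix N M c assume "N \<in> {N \<in> feas n. near n (h n) N}" "M \<in> {N \<in> feas n. near n (h n) N}" "shift v N = shift v M"
  then show "N c = M c" using real_shift[OF _ _ assms, of N c] real_shift[OF _ _ assms, of M c] by simp
qed

section \<open>The mean slack\<close>

definition "mslack n = avg n slack"

lemma mslack_nonneg: "mslack n \<ge> 0"
  unfolding mslack_def avg_def using Nrm_nonneg
  by (intro divide_nonneg_nonneg sum_wt_nonneg) (auto simp: feas_def)

text \<open>Exchanging one \<open>a\<close> for a \<open>b\<close> lowers the slack by
  \<open>d\<close>, raises the weight by at least the exponential factor, and injects the window
  counts with slack at least \<open>d\<close> into the feasible ones.\<close>

lemma mslack_recursion:
  assumes n: "n > 0" "3 * h n \<le> n * \<kappa> / 2" "h n \<ge> 1" and Z: "Nrm n > 0"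
  shows "mslack n \<ge> exp (X - 6 * h n / (n * \<kappa>) - err n (3 * h n))
           * (mslack n - d - real n * F * bad n (h n))"
proof -
  define \<rho> where "\<rho> = exp (X - 6 * h n / (n * \<kappa>) - err n (3 * h n))"
  define v :: "'a \<Rightarrow> int" where "v c = (if c = b then 1 else 0) - (if c = a then 1 else 0)" for c
  have v: "sum v UNIV = 0" "\<And>c. \<bar>real_of_int (v c)\<bar> \<le> 2 * h n"
    using n by (simp_all add: v_def sum_subtractf)
  have gv: "gap (\<lambda>c. real_of_int (v c)) = - d"
  proof -
    have "gap (\<lambda>c. real_of_int (v c)) = (\<Sum>c\<in>UNIV. (if c = b then I - f c else 0) - (if c = a then I - f c else 0))"
      unfolding gap_def by (intro sum.cong) (auto simp: v_def)
    then show ?thesis by (simp add: sum_subtractf d_def)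
  qed
  note sh = shift[OF _ _ v n(1,2)]
  define D where "D = {N \<in> feas n. near n (h n) N \<and> slack N \<ge> d}"
  have D: "N \<in> feas n" "near n (h n) N" "slack N \<ge> d" if "N \<in> D" for N using that by (auto simp: D_def)
  have nk: "n * \<kappa> > 0" using n \<kappa>_pos by simp
  \<comment> \<open>For each of the two moved letters the square grows by at most
    \<open>2 * h n + 1\<close>, hence by at most \<open>6 * h n\<close>.\<close>
  have quad: "quad n (shift v N) - quad n N \<le> 6 * h n / (n * \<kappa>)" if N: "N \<in> feas n" "near n (h n) N" for N
  proof -
    have "quad n (shift v N) - quad n N
       = (\<Sum>c\<in>UNIV. ((real (shift v N c) - n * P c)\<^sup>2 - (real (N c) - n * P c)\<^sup>2) / (2 * (n * P c)))"
      by (simp add: quad_def diff_divide_distrib sum_subtractf)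
    also have "\<dots> \<le> (\<Sum>c\<in>UNIV. (if c = b then 3 * h n / (n * \<kappa>) else 0) + (if c = a then 3 * h n / (n * \<kappa>) else 0))"
    proof (rule sum_mono)
      fix c
      define x where "x = real (N c) - n * P c"
      have sx: "real (shift v N c) - n * P c = x + v c" using sh(1)[OF N] by (simp add: x_def)
      have x: "\<bar>x\<bar> \<le> h n" using N by (simp add: near_def x_def)
      have "((x + v c)\<^sup>2 - x\<^sup>2) / (2 * (n * P c)) \<le> 3 * h n / (n * \<kappa>)" if "v c = 1 \<or> v c = -1"
      proof -
        have "(x + v c)\<^sup>2 - x\<^sup>2 \<le> 2 * (3 * h n)"
          using that x n(3) by (auto simp: power2_eq_square algebra_simps abs_le_iff)
        then have "((x + v c)\<^sup>2 - x\<^sup>2) / (2 * (n * P c)) \<le> (2 * (3 * h n)) / (2 * (n * P c))"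
          using P_pos[of c] by (intro divide_right_mono) (auto simp: less_imp_le)
        also have "\<dots> \<le> (2 * (3 * h n)) / (2 * (n * \<kappa>))"
          using \<kappa>_le[of c] \<kappa>_pos P_pos[of c] n by (intro divide_left_mono mult_pos_pos) (auto simp: mult_left_mono)
        finally show ?thesis by (simp add: mult.commute)
      qed
      then show "((real (shift v N c) - n * P c)\<^sup>2 - (real (N c) - n * P c)\<^sup>2) / (2 * (n * P c))
         \<le> (if c = b then 3 * h n / (n * \<kappa>) else 0) + (if c = a then 3 * h n / (n * \<kappa>) else 0)"
        using ab unfolding sx x_def[symmetric] by (auto simp: v_def)
    qed
    also have "\<dots> = 6 * h n / (n * \<kappa>)" by (simp add: sum.distrib)
    finally show ?thesis .
  qed
  have wt: "wt (shift v N) \<ge> wt N * \<rho>" if "N \<in> D" for N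
  proof -
    have "exp (quad n N - quad n (shift v N) - err n (3 * h n) - \<theta> * gap (\<lambda>c. real_of_int (v c))) \<ge> \<rho>"
      using quad[OF D(1,2)[OF that]] by (simp add: \<rho>_def gv X_def)
    then have "wt N * \<rho> \<le> wt N * exp (quad n N - quad n (shift v N) - err n (3 * h n) - \<theta> * gap (\<lambda>c. real_of_int (v c)))"
      using wt_pos[of N] by (intro mult_left_mono) auto
    also have "\<dots> \<le> wt (shift v N)" by (rule sh(5)[OF D(1,2)[OF that]])
    finally show ?thesis .
  qed
  have img: "shift v ` D \<subseteq> feas n"
    using sh(2,3) D gv by (auto simp: feas_def)
  have "inj_on (shift v) D"
    by (rule inj_on_subset[OF inj_on_shift[OF v n(1,2)]]) (auto simp: D_def)
  then have "(\<Sum>N\<in>D. wt (shift v N) * slack (shift v N)) = (\<Sum>N\<in>shift v ` D. wt N * slack N)"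
    by (simp add: sum.reindex)
  also have "\<dots> \<le> (\<Sum>N\<in>feas n. wt N * slack N)"
    using img wt_pos by (intro sum_mono2) (auto simp: feas_def less_imp_le)
  finally have 1: "(\<Sum>N\<in>D. wt (shift v N) * slack (shift v N)) \<le> mslack n * Nrm n"
    using Z by (simp add: mslack_def avg_def)
  have "\<rho> * (\<Sum>N\<in>D. wt N * (slack N - d)) \<le> (\<Sum>N\<in>D. wt (shift v N) * slack (shift v N))"
    unfolding sum_distrib_left
  proof (rule sum_mono)
    fix N assume N: "N \<in> D"
    have "slack (shift v N) = slack N - d" using sh(2)[OF D(1,2)[OF N]] gv by simp
    moreover have "wt N * \<rho> * (slack N - d) \<le> wt (shift v N) * (slack N - d)"
      using wt[OF N] D(3)[OF N] by (intro mult_right_mono) auto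
    ultimately show "\<rho> * (wt N * (slack N - d)) \<le> wt (shift v N) * slack (shift v N)"
      by (simp add: mult_ac)
  qed
  \<comment> \<open>Outside \<open>D\<close> the left summand is not positive: either the slack is
    below \<open>d\<close>, or the window is left and \<open>slack_le\<close> applies.\<close>
  moreover have "(\<Sum>N\<in>feas n. wt N * (slack N - d - real n * F * of_bool (\<not> near n (h n) N))) \<le> (\<Sum>N\<in>D. wt N * (slack N - d))"
  proof -
    have "(\<Sum>N\<in>feas n. wt N * (slack N - d - real n * F * of_bool (\<not> near n (h n) N)))
       \<le> (\<Sum>N\<in>feas n. if N \<in> D then wt N * (slack N - d) else 0)"
    proof (rule sum_mono)
      fix N assume N: "N \<in> feas n"
      have "slack N \<le> n * F" using N by (intro slack_le) (simp add: feas_def)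
      then have "slack N - d - real n * F * of_bool (\<not> near n (h n) N) \<le> (if N \<in> D then slack N - d else 0)"
        using N d_pos by (auto simp: D_def)
      then have "wt N * (slack N - d - real n * F * of_bool (\<not> near n (h n) N)) \<le> wt N * (if N \<in> D then slack N - d else 0)"
        using wt_pos[of N] by (intro mult_left_mono) auto
      then show "wt N * (slack N - d - real n * F * of_bool (\<not> near n (h n) N)) \<le> (if N \<in> D then wt N * (slack N - d) else 0)"
        by (cases "N \<in> D") (simp_all only: if_True if_False mult_zero_right)
    qed
    also have "\<dots> = (\<Sum>N\<in>D. wt N * (slack N - d))"
      by (rule sum.mono_neutral_cong_right) (auto simp: D_def)
    finally show ?thesis .
  qed
  moreover have "(\<Sum>N\<in>feas n. wt N * (slack N - d - real n * F * of_bool (\<not> near n (h n) N)))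
      = Nrm n * (mslack n - d - real n * F * bad n (h n))"
  proof -
    have "avg n (\<lambda>N. slack N - d - real n * F * of_bool (\<not> near n (h n) N)) = mslack n - d - real n * F * bad n (h n)"
      using Z by (simp add: avg_diff avg_const avg_scale mslack_def bad_def)
    then show ?thesis using Z by (simp add: avg_def field_simps)
  qed
  ultimately have "\<rho> * (Nrm n * (mslack n - d - real n * F * bad n (h n))) \<le> mslack n * Nrm n"
    using 1 by (smt (verit) \<rho>_def exp_ge_zero mult_left_mono)
  then have "Nrm n * (\<rho> * (mslack n - d - real n * F * bad n (h n))) \<le> Nrm n * mslack n"
    by (simp add: mult_ac)
  then show ?thesis using Z by (simp add: \<rho>_def)
qed

text \<open>Solving the recursion for \<open>mslack n\<close> gives the limiting bound
  \<open>X * exp X / (exp X - 1)\<close>, which is below \<open>X + 1\<close> because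
  \<open>exp X > 1 + X\<close>.\<close>

lemma eventually_mslack_le: "\<forall>\<^sub>F n in sequentially. \<theta> * mslack n \<le> X + 1"
proof -
  define \<rho> where "\<rho> n = exp (X - 6 * h n / (n * \<kappa>) - err n (3 * h n))" for n :: nat
  define U where "U n = \<theta> * (\<rho> n * (d + F * (real n * bad n (h n))) / (\<rho> n - 1))" for n
  have "(\<lambda>n. 6 * h n / (real n * \<kappa>)) \<longlonglongrightarrow> 0"
    unfolding h_def using \<kappa>_pos by real_asymp
  then have "(\<lambda>n. exp (X - 6 * h n / (real n * \<kappa>) - err n (3 * h n))) \<longlonglongrightarrow> exp (X - 0 - 0)"
    by (intro tendsto_intros err_tendsto)
  then have \<rho>: "\<rho> \<longlonglongrightarrow> exp X" by (simp add: \<rho>_def[abs_def])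
  have X1: "exp X > 1 + X"
    using exp_lower_Taylor_quadratic[of X] X_pos zero_less_power[OF X_pos, of 2] by linarith
  have "(\<lambda>n. \<theta> * (\<rho> n * (d + F * (real n * bad n (h n))) / (\<rho> n - 1)))
        \<longlonglongrightarrow> \<theta> * (exp X * (d + F * 0) / (exp X - 1))"
    using X1 X_pos by (intro tendsto_intros \<rho> n_bad_tendsto) auto
  then have "U \<longlonglongrightarrow> \<theta> * (exp X * (d + F * 0) / (exp X - 1))" by (simp add: U_def[abs_def])
  moreover have "\<theta> * (exp X * (d + F * 0) / (exp X - 1)) < X + 1"
  proof -
    have "\<theta> * (exp X * (d + F * 0) / (exp X - 1)) = X * exp X / (exp X - 1)" by (simp add: X_def)
    also have "\<dots> < X + 1" using X1 X_pos by (subst pos_divide_less_eq) (auto simp: algebra_simps)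
    finally show ?thesis .
  qed
  ultimately have U: "\<forall>\<^sub>F n in sequentially. U n \<le> X + 1" by (rule tendsto_le_eventually)
  have "\<forall>\<^sub>F n in sequentially. \<rho> n > 1"
    using order_tendstoD(1)[OF \<rho>, of 1] X1 X_pos by simp
  then show ?thesis using U eventually_h[of 1] eventually_Nrm_pos
  proof eventually_elim
    case (elim n)
    have "mslack n \<ge> \<rho> n * (mslack n - d - real n * F * bad n (h n))"
      unfolding \<rho>_def using elim by (intro mslack_recursion) auto
    then have "mslack n * (\<rho> n - 1) \<le> \<rho> n * (d + F * (real n * bad n (h n)))"
      by (simp add: algebra_simps)
    then have "mslack n \<le> \<rho> n * (d + F * (real n * bad n (h n))) / (\<rho> n - 1)"
      using elim by (simp add: pos_le_divide_eq)
    then have "\<theta> * mslack n \<le> U n" unfolding U_def using \<theta>_pos by (intro mult_left_mono) auto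
    then show ?case using elim by linarith
  qed
qed

section \<open>The drift of the mean counts from \<open>n * P\<close>\<close>

definition "drift n c = avg n (\<lambda>N. real (N c)) - real n * P c"

lemma drift_eq_avg: "Nrm n > 0 \<Longrightarrow> drift n c = avg n (\<lambda>N. real (N c) - real n * P c)"
  by (simp add: drift_def avg_diff avg_const)

lemma sum_drift:
  assumes "Nrm n > 0" shows "(\<Sum>c\<in>UNIV. drift n c) = 0"
proof -
  have "(\<Sum>c\<in>UNIV. avg n (\<lambda>N. real (N c))) = avg n (\<lambda>N. real (sum N UNIV))"
    by (simp add: avg_sum)
  also have "\<dots> = avg n (\<lambda>N. real n)"
    unfolding avg_def by (intro arg_cong2[where f="(/)"] sum.cong) (auto simp: feas_def types_def)
  finally show ?thesis
    using assms by (simp add: drift_def sum_subtractf avg_const P_sum flip: sum_distrib_left)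
qed

lemma gap_drift: "gap (drift n) = mslack n"
proof -
  have "mslack n = avg n (\<lambda>N. \<Sum>c\<in>UNIV. (I - f c) * real (N c))"
    unfolding mslack_def gap_def by (simp add: mult.commute)
  also have "\<dots> = (\<Sum>c\<in>UNIV. (I - f c) * avg n (\<lambda>N. real (N c)))" by (simp only: avg_sum avg_scale)
  finally have "gap (\<lambda>c. avg n (\<lambda>N. real (N c))) = mslack n" by (simp add: gap_def mult.commute)
  then show ?thesis by (simp add: drift_def[abs_def] gap_diff gap_scale gap_P)
qed

lemma abs_drift_le:
  assumes "Nrm n > 0"
  shows "\<bar>drift n c\<bar> \<le> h n + real n * bad n (h n)"
proof -
  have dev: "\<bar>real (N c) - real n * P c\<bar> \<le> h n + real n * of_bool (\<not> near n (h n) N)" if "N \<in> feas n" for N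
  proof (cases "near n (h n) N")
    case False
    have "real (N c) \<le> n" using types_le[of N n c] that by (simp add: feas_def)
    moreover have "real n * P c \<le> n" "real n * P c \<ge> 0"
      using P_le_1[of c] P_pos[of c] by (auto simp: mult_left_le less_imp_le)
    ultimately show ?thesis using False h_nonneg[of n] by simp
  qed (auto simp: near_def)
  have "avg n (\<lambda>N. h n + real n * of_bool (\<not> near n (h n) N)) = h n + real n * bad n (h n)"
    using assms by (simp add: avg_add avg_const avg_scale bad_def)
  moreover have "avg n (\<lambda>N. real (N c) - real n * P c) \<le> avg n (\<lambda>N. h n + real n * of_bool (\<not> near n (h n) N))"
    by (rule avg_mono) (use dev in \<open>auto simp: abs_le_iff\<close>)
  moreover have "avg n (\<lambda>N. - 1 * (real (N c) - real n * P c)) \<le> avg n (\<lambda>N. h n + real n * of_bool (\<not> near n (h n) N))"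
    by (rule avg_mono) (use dev in \<open>auto simp: abs_le_iff\<close>)
  ultimately show ?thesis unfolding avg_scale using drift_eq_avg[OF assms, of c] by linarith
qed

lemma eventually_drift_small: "\<forall>\<^sub>F n in sequentially. \<forall>c. \<bar>drift n c\<bar> \<le> h n + 1"
proof -
  have "\<forall>\<^sub>F n in sequentially. real n * bad n (h n) \<le> 1"
    by (rule tendsto_le_eventually[OF n_bad_tendsto]) simp
  then show ?thesis using eventually_Nrm_pos
  proof eventually_elim
    case (elim n)
    show ?case
    proof
      fix c show "\<bar>drift n c\<bar> \<le> h n + 1" using abs_drift_le[OF elim(2), of c] elim(1) by linarith
    qed
  qed
qed

text \<open>Since the log-ratio is affine in \<open>N\<close>, its mean is \<open>\<Sum> (u\<^sup>2 - (u + v)\<^sup>2) / (2 n P)\<close> for the drift \<open>u\<close>.\<close>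

lemma drift_shift_bound:
  fixes v :: "'a \<Rightarrow> int"
  assumes v: "sum v UNIV = 0" "\<And>c. \<bar>real_of_int (v c)\<bar> \<le> 2 * h n"
    and gv: "0 \<le> gap (\<lambda>c. real_of_int (v c))" "gap (\<lambda>c. real_of_int (v c)) \<le> d"
    and vd: "\<And>c. \<bar>v c + drift n c\<bar> \<le> C"
    and n: "n > 0" "3 * h n \<le> n * \<kappa> / 2" "h n \<le> n" and Z: "Nrm n > 0"
  shows "(\<Sum>c\<in>UNIV. (drift n c)\<^sup>2 / (2 * (n * P c)))
     \<le> X + err n (3 * h n) + (1 + 4 * L * n / \<kappa>) * bad n (h n) + L * (C\<^sup>2 / (2 * (n * \<kappa>)))"
proof -
  note sh = shift[OF _ _ v n(1,2)]
  define e where "e = err n (3 * h n)"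
  define B where "B = 1 + 4 * L * n / \<kappa>"
  have e0: "e \<ge> 0" using err_nonneg h_nonneg by (simp add: e_def)
  have nk: "n * \<kappa> > 0" using n \<kappa>_pos by simp
  \<comment> \<open>The untruncated log-ratio, defined for all counts so that its average over all
    feasible ones can be computed exactly.\<close>
  define lin where "lin N = (\<Sum>c\<in>UNIV. - (2 * (real (N c) - n * P c) * v c + (real_of_int (v c))\<^sup>2) / (2 * (n * P c)))"
    for N :: "'a \<Rightarrow> nat"
  have lin: "quad n N - quad n (shift v N) = lin N" if N: "N \<in> feas n" "near n (h n) N" for N
    unfolding quad_def lin_def sum_subtractf[symmetric] sh(1)[OF N]
    by (intro sum.cong refl) (simp add: diff_divide_distrib[symmetric] power2_eq_square algebra_simps)
  have lin_le: "lin N \<le> 4 * L * n / \<kappa>" if N: "N \<in> feas n" for N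
  proof -
    have "lin N \<le> (\<Sum>c\<in>(UNIV::'a set). 4 * n / \<kappa>)" unfolding lin_def
    proof (rule sum_mono)
      fix c
      have "real (N c) \<le> n" using types_le[of N n c] that by (simp add: feas_def)
      moreover have "real n * P c \<le> n" "real n * P c \<ge> 0"
        using P_le_1[of c] P_pos[of c] by (auto simp: mult_left_le less_imp_le)
      ultimately have x: "\<bar>real (N c) - n * P c\<bar> \<le> n" by simp
      have vc: "\<bar>real_of_int (v c)\<bar> \<le> 2 * n" using v(2)[of c] n by linarith
      have "- ((real (N c) - n * P c) * v c) \<le> \<bar>real (N c) - n * P c\<bar> * \<bar>real_of_int (v c)\<bar>"
        unfolding abs_mult[symmetric] by (rule abs_ge_minus_self)
      then have "- (2 * (real (N c) - n * P c) * v c + (real_of_int (v c))\<^sup>2) \<le> 2 * (\<bar>real (N c) - n * P c\<bar> * \<bar>real_of_int (v c)\<bar>)"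
        using zero_le_power2[of "real_of_int (v c)"] by linarith
      also have "\<dots> \<le> 2 * (real n * (2 * n))" using x vc by (intro mult_left_mono mult_mono) auto
      finally have num: "- (2 * (real (N c) - n * P c) * v c + (real_of_int (v c))\<^sup>2) \<le> 8 * real n * real n"
        using zero_le_square[of "real n"] by linarith
      have "- (2 * (real (N c) - n * P c) * v c + (real_of_int (v c))\<^sup>2) / (2 * (n * P c)) \<le> 8 * real n * real n / (2 * (n * P c))"
        using num P_pos[of c] by (intro divide_right_mono) (auto simp: less_imp_le)
      also have "\<dots> \<le> 8 * real n * real n / (2 * (n * \<kappa>))"
        using \<kappa>_le[of c] \<kappa>_pos P_pos[of c] n by (intro divide_left_mono mult_pos_pos) (auto simp: mult_left_mono)
      also have "\<dots> = 4 * n / \<kappa>" using n \<kappa>_pos by (simp add: field_simps)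
      finally show "- (2 * (real (N c) - n * P c) * v c + (real_of_int (v c))\<^sup>2) / (2 * (n * P c)) \<le> 4 * n / \<kappa>" .
    qed
    then show ?thesis by (simp add: L_card mult.left_commute mult.assoc)
  qed
  define G where "G = {N \<in> feas n. near n (h n) N}"
  have G: "N \<in> feas n" "near n (h n) N" if "N \<in> G" for N using that by (auto simp: G_def)
  have "shift v ` G \<subseteq> feas n" using sh(2,3) G gv by (auto simp: feas_def)
  then have "(\<Sum>N\<in>shift v ` G. wt N) \<le> Nrm n"
    unfolding Nrm_def using wt_pos by (intro sum_mono2) (auto simp: less_imp_le)
  moreover have "inj_on (shift v) G" unfolding G_def by (rule inj_on_shift[OF v n(1,2)])
  ultimately have "(\<Sum>N\<in>G. wt (shift v N)) \<le> Nrm n" by (simp add: sum.reindex)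
  \<comment> \<open>\<open>exp t \<ge> 1 + t\<close> replaces the weight ratio by an expression
    affine in \<open>N\<close>.\<close>
  moreover have "(\<Sum>N\<in>G. wt N * (1 - X - e + lin N)) \<le> (\<Sum>N\<in>G. wt (shift v N))"
  proof (rule sum_mono)
    fix N assume N: "N \<in> G"
    have "\<theta> * gap (\<lambda>c. real_of_int (v c)) \<le> X" using gv \<theta>_pos by (simp add: X_def)
    then have "1 - X - e + lin N \<le> 1 + (lin N - e - \<theta> * gap (\<lambda>c. real_of_int (v c)))" by simp
    also have "\<dots> \<le> exp (lin N - e - \<theta> * gap (\<lambda>c. real_of_int (v c)))" by (rule exp_ge_add_one_self)
    finally have "wt N * (1 - X - e + lin N) \<le> wt N * exp (lin N - e - \<theta> * gap (\<lambda>c. real_of_int (v c)))"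
      using wt_pos[of N] by (intro mult_left_mono) auto
    also have "\<dots> \<le> wt (shift v N)" using sh(5)[OF G[OF N]] by (simp add: lin[OF G[OF N]] e_def)
    finally show "wt N * (1 - X - e + lin N) \<le> wt (shift v N)" .
  qed
  \<comment> \<open>\<open>B\<close> dominates \<open>1 + lin N\<close> by \<open>lin_le\<close>, so
    the summands outside the window are not positive.\<close>
  moreover have "(\<Sum>N\<in>feas n. wt N * (1 - X - e + lin N - B * of_bool (\<not> near n (h n) N))) \<le> (\<Sum>N\<in>G. wt N * (1 - X - e + lin N))"
  proof -
    have "(\<Sum>N\<in>feas n. wt N * (1 - X - e + lin N - B * of_bool (\<not> near n (h n) N)))
      \<le> (\<Sum>N\<in>feas n. if N \<in> G then wt N * (1 - X - e + lin N) else 0)"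
    proof (rule sum_mono)
      fix N assume N: "N \<in> feas n"
      have "1 - X - e + lin N - B * of_bool (\<not> near n (h n) N) \<le> (if N \<in> G then 1 - X - e + lin N else 0)"
        using N lin_le[OF N] X_pos e0 by (auto simp: G_def B_def)
      then have "wt N * (1 - X - e + lin N - B * of_bool (\<not> near n (h n) N)) \<le> wt N * (if N \<in> G then 1 - X - e + lin N else 0)"
        using wt_pos[of N] by (intro mult_left_mono) auto
      then show "wt N * (1 - X - e + lin N - B * of_bool (\<not> near n (h n) N)) \<le> (if N \<in> G then wt N * (1 - X - e + lin N) else 0)"
        by (cases "N \<in> G") (simp_all only: if_True if_False mult_zero_right)
    qed
    also have "\<dots> = (\<Sum>N\<in>G. wt N * (1 - X - e + lin N))"
      by (rule sum.mono_neutral_cong_right) (auto simp: G_def)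
    finally show ?thesis .
  qed
  ultimately have "(\<Sum>N\<in>feas n. wt N * (1 - X - e + lin N - B * of_bool (\<not> near n (h n) N))) \<le> Nrm n"
    by linarith
  then have "avg n (\<lambda>N. 1 - X - e + lin N - B * of_bool (\<not> near n (h n) N)) \<le> 1"
    using Z by (simp add: avg_def)
  moreover have "avg n (\<lambda>N. 1 - X - e + lin N - B * of_bool (\<not> near n (h n) N)) = 1 - X - e + avg n lin - B * bad n (h n)"
    using Z by (simp only: avg_diff avg_add avg_const avg_scale bad_def)
  ultimately have main: "avg n lin \<le> X + e + B * bad n (h n)" by linarith
  have split_sq: "- (2 * x * y + y\<^sup>2) / (2 * q) = (- y / q) * x - y\<^sup>2 / (2 * q)" if "q > 0" for x y q :: real
    using that by (simp add: field_simps)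
  have "avg n lin = (\<Sum>c\<in>UNIV. - (2 * drift n c * v c + (real_of_int (v c))\<^sup>2) / (2 * (n * P c)))"
  proof -
    have "avg n (\<lambda>N. - (2 * (real (N c) - n * P c) * v c + (real_of_int (v c))\<^sup>2) / (2 * (n * P c)))
       = - (2 * drift n c * v c + (real_of_int (v c))\<^sup>2) / (2 * (n * P c))" for c
    proof -
      have "avg n (\<lambda>N. - (2 * (real (N c) - n * P c) * v c + (real_of_int (v c))\<^sup>2) / (2 * (n * P c)))
         = avg n (\<lambda>N. (- real_of_int (v c) / (n * P c)) * (real (N c) - n * P c) - (real_of_int (v c))\<^sup>2 / (2 * (n * P c)))"
        using P_pos[of c] n by (intro arg_cong[of _ _ "avg n"] ext split_sq) simp
      also have "\<dots> = (- real_of_int (v c) / (n * P c)) * drift n c - (real_of_int (v c))\<^sup>2 / (2 * (n * P c))"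
        using Z by (simp only: avg_diff[where H = "\<lambda>_. (real_of_int (v c))\<^sup>2 / (2 * (n * P c))"] avg_scale avg_const drift_eq_avg)
      also have "\<dots> = - (2 * drift n c * v c + (real_of_int (v c))\<^sup>2) / (2 * (n * P c))"
        using P_pos[of c] n by (intro split_sq[symmetric]) simp
      finally show ?thesis .
    qed
    then show ?thesis unfolding lin_def[abs_def] avg_sum by simp
  qed
  \<comment> \<open>Completing the square: \<open>v\<close> is within \<open>C\<close> of the
    negative drift, so only a remainder of order \<open>C^2 / n\<close> is lost.\<close>
  also have "\<dots> \<ge> (\<Sum>c\<in>UNIV. (drift n c)\<^sup>2 / (2 * (n * P c)) - C\<^sup>2 / (2 * (n * \<kappa>)))"
  proof (rule sum_mono)
    fix c
    have "C \<ge> 0" using vd[of c] by linarith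
    then have "(v c + drift n c)\<^sup>2 \<le> C\<^sup>2" using vd[of c] by (simp add: abs_le_square_iff[symmetric])
    then have "(v c + drift n c)\<^sup>2 / (2 * (n * P c)) \<le> C\<^sup>2 / (2 * (n * \<kappa>))"
      using nk \<kappa>_le[of c] by (intro frac_le) (auto simp: mult_left_mono)
    moreover have "- (2 * drift n c * v c + (real_of_int (v c))\<^sup>2) = (drift n c)\<^sup>2 - (v c + drift n c)\<^sup>2"
      by (simp add: power2_eq_square algebra_simps)
    ultimately show "(drift n c)\<^sup>2 / (2 * (n * P c)) - C\<^sup>2 / (2 * (n * \<kappa>))
       \<le> - (2 * drift n c * v c + (real_of_int (v c))\<^sup>2) / (2 * (n * P c))"
      by (simp add: diff_divide_distrib)
  qed
  finally show ?thesis using main by (simp add: sum_subtractf L_card B_def e_def)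
qed

text \<open>The bound on the mean slack bounds \<open>gap (drift n)\<close> by a \<open>K\<close>
  independent of \<open>n\<close>; hence one rounding constant \<open>C\<close> serves all
  \<open>n\<close>, and the shift rounds the negative drift.\<close>

lemma eventually_drift_sq:
  assumes "\<epsilon> > 0"
  shows "\<forall>\<^sub>F n in sequentially. (\<Sum>c\<in>UNIV. (drift n c)\<^sup>2 / (2 * (n * P c))) \<le> X + \<epsilon>"
proof -
  define K where "K = (X + 1) / \<theta>"
  obtain C where C: "C \<ge> 0" and round: "\<And>(z::'a \<Rightarrow> real) (k::int). sum z UNIV = k \<Longrightarrow> \<bar>gap z\<bar> \<le> K \<Longrightarrow>
     (\<exists>v::'a \<Rightarrow> int. sum v UNIV = k \<and> 0 \<le> gap (\<lambda>c. real_of_int (v c)) \<and> gap (\<lambda>c. real_of_int (v c)) \<le> d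
        \<and> (\<forall>c. \<bar>v c - z c\<bar> \<le> C))"
    using integer_rounding[of K] by meson
  define U where "U n = X + err n (3 * h n) + (1 + 4 * L * n / \<kappa>) * bad n (h n) + L * (C\<^sup>2 / (2 * (n * \<kappa>)))" for n :: nat
  have b0: "(\<lambda>n. (1 + 4 * L * real n / \<kappa>) * bad n (h n)) \<longlonglongrightarrow> 0"
  proof (rule tendsto_sandwich[OF _ _ tendsto_const])
    show "(\<lambda>n. (1 + 4 * L / \<kappa>) * (real n * bad n (h n))) \<longlonglongrightarrow> 0"
      using tendsto_mult_left[OF n_bad_tendsto, of "1 + 4 * L / \<kappa>"] by simp
    show "\<forall>\<^sub>F n in sequentially. (1 + 4 * L * real n / \<kappa>) * bad n (h n) \<le> (1 + 4 * L / \<kappa>) * (real n * bad n (h n))"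
      using eventually_gt_at_top[of 0]
    proof eventually_elim
      case (elim n)
      then have "(1 + 4 * L * real n / \<kappa>) \<le> (1 + 4 * L / \<kappa>) * real n" by (simp add: distrib_right)
      then have "(1 + 4 * L * real n / \<kappa>) * bad n (h n) \<le> (1 + 4 * L / \<kappa>) * real n * bad n (h n)"
        using bad_nonneg by (intro mult_right_mono) auto
      then show ?case by (simp add: mult.assoc)
    qed
    show "\<forall>\<^sub>F n in sequentially. 0 \<le> (1 + 4 * L * real n / \<kappa>) * bad n (h n)"
      using L_ge_1 \<kappa>_pos bad_nonneg by (intro always_eventually allI mult_nonneg_nonneg) auto
  qed
  have c0: "(\<lambda>n. L * (C\<^sup>2 / (2 * (real n * \<kappa>)))) \<longlonglongrightarrow> 0"
    using \<kappa>_pos C L_ge_1 by real_asymp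
  have "U \<longlonglongrightarrow> X + 0 + 0 + 0"
    unfolding U_def[abs_def] by (intro tendsto_intros err_tendsto b0 c0)
  then have "\<forall>\<^sub>F n in sequentially. U n \<le> X + \<epsilon>"
    by (rule tendsto_le_eventually) (use assms in simp)
  then show ?thesis
    using eventually_mslack_le eventually_Nrm_pos eventually_h[of "C + 1"] eventually_drift_small
  proof eventually_elim
    case (elim n)
    have "\<bar>gap (\<lambda>c. - 1 * drift n c)\<bar> \<le> K"
      unfolding gap_scale gap_drift using elim(2) \<theta>_pos mslack_nonneg[of n]
      by (simp add: K_def pos_le_divide_eq mult.commute)
    moreover have "sum (\<lambda>c. - 1 * drift n c) UNIV = real_of_int 0"
      using sum_drift[OF elim(3)] by (simp add: sum_negf)
    ultimately obtain v :: "'a \<Rightarrow> int" where v: "sum v UNIV = 0" "0 \<le> gap (\<lambda>c. real_of_int (v c))"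
       "gap (\<lambda>c. real_of_int (v c)) \<le> d" "\<And>c. \<bar>v c - (- 1 * drift n c)\<bar> \<le> C"
      using round by meson
    have "(\<Sum>c\<in>UNIV. (drift n c)\<^sup>2 / (2 * (n * P c))) \<le> U n"
      unfolding U_def
    proof (rule drift_shift_bound[OF v(1) _ v(2,3)])
      fix c
      show "\<bar>v c + drift n c\<bar> \<le> C" using v(4)[of c] by simp
      moreover have "\<bar>drift n c\<bar> \<le> h n + 1" using elim by blast
      ultimately show "\<bar>real_of_int (v c)\<bar> \<le> 2 * h n" using elim by linarith
    qed (use elim in auto)
    then show ?case using elim by linarith
  qed
qed

section \<open>The mean type and its divergence from the tilted law\<close>

definition "mtype n c = avg n (\<lambda>N. real (N c) / real n)"

lemma mtype_eq: "n > 0 \<Longrightarrow> mtype n c = P c * (1 + drift n c / (n * P c))"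
proof -
  assume "n > 0"
  have "mtype n c = avg n (\<lambda>N. (1 / real n) * real (N c))" by (simp add: mtype_def)
  also have "\<dots> = (1 / real n) * (drift n c + n * P c)" unfolding avg_scale by (simp add: drift_def)
  moreover have "P c * (drift n c / (n * P c)) = drift n c / n" using P_pos[of c] by simp
  ultimately show ?thesis using \<open>n > 0\<close> by (simp add: distrib_left add_divide_distrib)
qed

text \<open>Writing the mean type as \<open>P c * (1 + y c)\<close>, the linear terms vanish since
  the drifts sum to 0, the quadratic ones are bounded by \<open>eventually_drift_sq\<close>, and the
  cubic ones are of order \<open>n powr (- 1/5)\<close>.\<close>

lemma eventually_mtype_divergence:
  assumes "\<epsilon> > 0"
  shows "\<forall>\<^sub>F n in sequentially. (\<forall>c. mtype n c > 0)
     \<and> real n * (\<Sum>c\<in>UNIV. mtype n c * ln (mtype n c / P c)) \<le> X + \<epsilon>"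
proof -
  have "\<forall>\<^sub>F n in sequentially. L * (real n * ((h n + 1) / (real n * \<kappa>)) ^ 3) \<le> \<epsilon> / 2"
    unfolding h_def using assms \<kappa>_pos L_ge_1 by real_asymp
  moreover have "\<forall>\<^sub>F n in sequentially. (h n + 1) / (real n * \<kappa>) < 1"
    unfolding h_def using \<kappa>_pos by real_asymp
  moreover have "\<forall>\<^sub>F n in sequentially. (\<Sum>c\<in>UNIV. (drift n c)\<^sup>2 / (2 * (n * P c))) \<le> X + \<epsilon> / 2"
    using assms by (intro eventually_drift_sq) simp
  ultimately show ?thesis using eventually_drift_small eventually_Nrm_pos eventually_gt_at_top[of 0]
  proof eventually_elim
    case (elim n)
    define y where "y c = drift n c / (n * P c)" for c
    have n: "n > 0" using elim by simp
    have yb: "\<bar>y c\<bar> \<le> (h n + 1) / (n * \<kappa>)" for c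
    proof -
      have "\<bar>y c\<bar> = \<bar>drift n c\<bar> / (n * P c)" using P_pos[of c] by (simp add: y_def abs_mult)
      also have "\<dots> \<le> (h n + 1) / (n * \<kappa>)"
        using elim(4) \<kappa>_le[of c] \<kappa>_pos n h_nonneg[of n] by (intro frac_le) (auto simp: mult_left_mono)
      finally show ?thesis .
    qed
    have y1: "\<bar>y c\<bar> < 1" for c using yb[of c] elim(2) by linarith
    have mt: "mtype n c = P c * (1 + y c)" for c using mtype_eq[OF n] by (simp add: y_def)
    have pos: "mtype n c > 0" for c
      unfolding mt using P_pos[of c] y1[of c] by (intro mult_pos_pos) auto
    have "real n * (\<Sum>c\<in>UNIV. mtype n c * ln (mtype n c / P c)) = (\<Sum>c\<in>UNIV. n * P c * ((1 + y c) * ln (1 + y c)))"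
      unfolding sum_distrib_left using P_pos[THEN less_imp_neq, THEN not_sym]
      by (intro sum.cong refl) (simp add: mt)
    also have "\<dots> \<le> (\<Sum>c\<in>UNIV. n * P c * (y c + (y c)\<^sup>2 / 2 + \<bar>y c\<bar> ^ 3))"
      using P_pos y1 by (intro sum_mono mult_left_mono mult_ln_le_cubic) (auto simp: less_imp_le)
    also have "\<dots> \<le> (\<Sum>c\<in>UNIV. drift n c + (drift n c)\<^sup>2 / (2 * (n * P c)) + real n * ((h n + 1) / (real n * \<kappa>)) ^ 3)"
    proof (rule sum_mono)
      fix c
      have "n * P c * \<bar>y c\<bar> ^ 3 \<le> real n * 1 * ((h n + 1) / (n * \<kappa>)) ^ 3"
        using P_pos[of c] P_le_1[of c] yb[of c] by (intro mult_mono power_mono) auto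
      moreover have "n * P c * y c = drift n c" using P_pos[of c] n by (simp add: y_def)
      moreover have "n * P c * ((y c)\<^sup>2 / 2) = (drift n c)\<^sup>2 / (2 * (n * P c))"
        using P_pos[of c] n by (simp add: y_def power2_eq_square)
      ultimately show "n * P c * (y c + (y c)\<^sup>2 / 2 + \<bar>y c\<bar> ^ 3)
         \<le> drift n c + (drift n c)\<^sup>2 / (2 * (n * P c)) + real n * ((h n + 1) / (real n * \<kappa>)) ^ 3"
        by (simp add: distrib_left)
    qed
    also have "\<dots> = (\<Sum>c\<in>UNIV. drift n c) + (\<Sum>c\<in>UNIV. (drift n c)\<^sup>2 / (2 * (n * P c))) + L * (real n * ((h n + 1) / (real n * \<kappa>)) ^ 3)"
      by (simp only: sum.distrib sum_constant L_card)
    also have "\<dots> \<le> X + \<epsilon>" using elim sum_drift[OF elim(5)] by linarith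
    finally show ?case using pos by blast
  qed
qed

text \<open>The tilting changes the mass of a type only through its slack and the common factor
  \<open>K\<close>, which cancels on normalising.\<close>

lemma mean_type_eq_mtype:
  fixes Q :: "'a \<Rightarrow> real"
  assumes Z: "Z > 0" and Q: "\<And>c. Q c = P c * (Z * exp (\<theta> * f c))" and n: "n > 0"
  shows "mean_type Q f I n c = mtype n c"
proof -
  define K where "K = (Z * exp (\<theta> * I)) ^ n"
  have K: "K > 0" using Z by (simp add: K_def)
  have mQ: "mass Q N = K * wt N" if N: "N \<in> types n" for N
  proof -
    have "(\<Prod>c\<in>UNIV. (Z * exp (\<theta> * f c)) ^ N c) = Z ^ n * exp (\<Sum>c\<in>UNIV. \<theta> * (N c * f c))"
      using N by (simp add: power_mult_distrib prod.distrib types_def exp_sum exp_of_nat_mult[symmetric]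
          power_sum[symmetric] mult_ac)
    also have "(\<Sum>c\<in>UNIV. \<theta> * (N c * f c)) = n * (\<theta> * I) + - \<theta> * slack N"
      using N by (simp add: gap_def types_def right_diff_distrib sum_subtractf sum_distrib_left[symmetric]
          sum_distrib_right[symmetric] of_nat_sum[symmetric] algebra_simps del: of_nat_sum)
    also have "exp \<dots> = exp (\<theta> * I) ^ n * exp (- \<theta> * slack N)"
      by (simp only: exp_add exp_of_nat_mult)
    finally show ?thesis
      unfolding Q[abs_def] mass_scale by (simp add: K_def wt_def power_mult_distrib mult_ac)
  qed
  have type_iff: "xs \<in> typical_set f I n \<longleftrightarrow> length xs = n \<and> count_list xs \<in> feas n" for xs
  proof (cases "length xs = n")
    case True
    have ty: "count_list xs \<in> types n" using count_list_in_types[of xs] True by simp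
    then have s: "(\<Sum>c\<in>UNIV. real (count_list xs c)) = n" by (simp add: types_def flip: of_nat_sum)
    have "is_pmf (emp_pmf xs)"
      using n s True by (simp add: is_pmf_def emp_pmf_def flip: sum_divide_distrib)
    moreover have "slack (count_list xs) = n * (I - expect f (emp_pmf xs))"
    proof -
      have "slack (count_list xs) = n * I - (\<Sum>c\<in>UNIV. real (count_list xs c) * f c)"
        using s by (simp add: gap_def right_diff_distrib sum_subtractf flip: sum_distrib_right)
      also have "(\<Sum>c\<in>UNIV. real (count_list xs c) * f c) = n * expect f (emp_pmf xs)"
        using n True by (simp add: expect_def emp_pmf_def sum_distrib_left)
      finally show ?thesis by (simp add: right_diff_distrib)
    qed
    ultimately show ?thesis
      using n ty True by (simp add: typical_set_def constr_set_def feas_def zero_le_mult_iff)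
  qed (auto simp: typical_set_def)
  have feas_sum: "(\<Sum>xs | length xs = n. iid Q xs * (of_bool (count_list xs \<in> feas n) * G (count_list xs)))
      = K * (\<Sum>N\<in>feas n. wt N * G N)" for G
  proof -
    have "(\<Sum>xs | length xs = n. iid Q xs * (of_bool (count_list xs \<in> feas n) * G (count_list xs)))
       = (\<Sum>N\<in>types n. mass Q N * (of_bool (N \<in> feas n) * G N))"
      by (rule sum_lists_by_type)
    also have "\<dots> = (\<Sum>N\<in>feas n. mass Q N * G N)"
      by (rule sum.mono_neutral_cong_right) (auto simp: feas_def)
    also have "\<dots> = (\<Sum>N\<in>feas n. K * (wt N * G N))"
      by (rule sum.cong) (auto simp: feas_def mQ)
    finally show ?thesis by (simp add: sum_distrib_left)
  qed
  have den: "(\<Sum>ys\<in>typical_set f I n. iid Q ys) = K * Nrm n"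
  proof -
    have "(\<Sum>ys\<in>typical_set f I n. iid Q ys) = (\<Sum>xs | length xs = n. iid Q xs * (of_bool (count_list xs \<in> feas n) * 1))"
      by (rule sum.mono_neutral_cong_left) (auto simp: type_iff)
    then show ?thesis using feas_sum[of "\<lambda>_. 1"] by (simp add: Nrm_def)
  qed
  have "mean_type Q f I n c = (\<Sum>xs | length xs = n. iid Q xs * (of_bool (count_list xs \<in> feas n) * (count_list xs c / n / (K * Nrm n))))"
    unfolding mean_type_def
    by (intro sum.cong refl) (simp add: cond_pmf_def type_iff den emp_pmf_def)
  also have "\<dots> = K * (\<Sum>N\<in>feas n. wt N * (N c / n / (K * Nrm n)))" by (rule feas_sum)
  also have "\<dots> = mtype n c"
    using K by (simp add: mtype_def avg_def sum_distrib_left sum_divide_distrib)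
  finally show ?thesis .
qed

text \<open>The mean of \<open>f\<close> falls short of \<open>I\<close> by
  \<open>mslack n / n\<close>, which is how the slack enters the excess divergence.\<close>

lemma mtype_pmf:
  assumes "Nrm n > 0" "n > 0"
  shows "mtype n c \<ge> 0" "sum (mtype n) UNIV = 1" "expect f (mtype n) = I - mslack n / n"
proof -
  show "mtype n c \<ge> 0" unfolding mtype_def avg_def
    using assms by (intro divide_nonneg_nonneg sum_wt_nonneg) auto
  have mt: "mtype n c = P c + drift n c / n" for c
    using mtype_eq[OF assms(2), of c] P_pos[of c] assms(2) by (simp add: distrib_left)
  show s: "sum (mtype n) UNIV = 1"
    using sum_drift[OF assms(1)] by (simp add: mt[abs_def] sum.distrib P_sum flip: sum_divide_distrib)
  have "gap (mtype n) = gap (\<lambda>c. P c + 1 / n * drift n c)" by (simp add: mt[abs_def])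
  also have "\<dots> = mslack n / n" unfolding gap_add gap_scale gap_P gap_drift by simp
  finally show "expect f (mtype n) = I - mslack n / n"
    using s by (simp add: gap_def expect_def right_diff_distrib sum_subtractf flip: sum_distrib_right)
qed

end

section \<open>Identification of the minimiser and comparison of the constants\<close>

theorem theorem2:
  fixes Q :: "'a::finite \<Rightarrow> real" and f :: "'a \<Rightarrow> real" and I :: real
    and Pstar :: "'a \<Rightarrow> real"
  assumes Q_pmf: "is_pmf Q"
    and Q_pos: "Min (range Q) > 0"
    and I_low: "Min (range f) < I"
    and I_high: "I < expect f Q"
    and Pstar_in: "Pstar \<in> constr_set f I"
    and Pstar_min: "\<And>P. P \<in> constr_set f I \<Longrightarrow> kl_div Pstar Q \<le> kl_div P Q"
  defines "c \<equiv> (real CARD('a) - 1) *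
      log 2 ((Max (range Pstar) * Max (range Q)) / (Min (range Pstar) * Min (range Q)))"
  shows "(\<forall>\<^sub>F n in sequentially.
            kl_div (mean_type Q f I n) Pstar
              \<le> kl_div (mean_type Q f I n) Q - kl_div Pstar Q)
       \<and> (\<exists>g :: nat \<Rightarrow> real. g \<longlonglongrightarrow> 0 \<and>
            (\<forall>\<^sub>F n in sequentially.
               kl_div (mean_type Q f I n) Q - kl_div Pstar Q
                 < (1 / real n) * 2 powr (c + 1) * (1 + g n)))"
proof -
  have Qp: "Q x > 0" for x using Q_pos by (simp add: Min_gr_iff)
  have Qs: "sum Q UNIV = 1" using Q_pmf by (simp add: is_pmf_def)
  obtain P \<theta> Z where th: "\<theta> > 0" and Z: "Z > 0" and Pp: "\<And>x. P x > 0"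
    and PQ: "\<And>x. Q x = P x * (Z * exp (\<theta> * f x))" and Ps: "sum P UNIV = 1" and Pm: "(\<Sum>x\<in>UNIV. P x * f x) = I"
    by (rule exists_tilting[OF Qp Qs I_low I_high]) (rule that)
  have EP: "expect f P = I" by (simp add: expect_def Pm)
  note diff = tilted_kl_div_diff[OF Qp Z PQ Ps]
  \<comment> \<open>In the Pythagorean identity the mean term is nonnegative on the constraint set,
    so minimality forces the divergence from \<open>P\<close> to be at most 0.\<close>
  have "Pstar = P"
  proof -
    have S: "\<And>x. Pstar x \<ge> 0" "sum Pstar UNIV = 1" "expect f Pstar \<le> I"
      using Pstar_in by (auto simp: constr_set_def is_pmf_def)
    have "P \<in> constr_set f I" using Pp Ps EP by (simp add: constr_set_def is_pmf_def less_imp_le)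
    then have "kl_div Pstar Q \<le> kl_div P Q" by (rule Pstar_min)
    moreover have "\<theta> * (expect f P - expect f Pstar) / ln 2 \<ge> 0"
      using S(3) th by (simp add: EP)
    ultimately have "kl_div Pstar P \<le> 0" using diff[OF S(1,2)] by linarith
    then show ?thesis by (rule kl_div_le_0_imp_eq[OF S(1,2) Pp Ps])
  qed
  have "Min (range f) \<in> range f" by (intro Min_in) auto
  then obtain a where a: "f a = Min (range f)" by force
  \<comment> \<open>Otherwise \<open>f\<close> is constant and no \<open>I\<close> lies strictly
    between its minimum and its mean.\<close>
  have "\<exists>b. f a < f b"
  proof (rule ccontr)
    assume "\<not> ?thesis"
    then have "f b \<le> f a" for b by (simp add: not_less)
    then have "expect f Q \<le> (\<Sum>x\<in>UNIV. Q x * f a)"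
      unfolding expect_def using Qp by (intro sum_mono mult_left_mono) (auto simp: less_imp_le)
    also have "\<dots> = f a" using Qs by (simp flip: sum_distrib_right)
    finally show False using I_low I_high a by linarith
  qed
  then obtain b where b: "f a < f b" by blast
  interpret tilted P f I \<theta> "Min (range P)" "real CARD('a)" a b
    using Pp Ps Pm th b by unfold_locales (auto simp: Min_gr_iff)
  define M where "M = (Max (range P) * Max (range Q)) / (Min (range P) * Min (range Q))"
  have minP: "Min (range P) > 0" using Pp by (simp add: Min_gr_iff)
  have "P a \<le> Max (range P)" "Q a \<le> Max (range Q)" by auto
  then have maxs: "Max (range P) \<ge> 0" "Max (range Q) \<ge> 0" using Pp[of a] Qp[of a] by linarith+
  \<comment> \<open>The normaliser \<open>Z\<close> cancels in \<open>Q b / Q a\<close>, leaving a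
    ratio of four probabilities to be bounded by the extremal ones.\<close>
  have eX: "exp X \<le> M"
  proof -
    have "exp X = (P a * Q b) / (P b * Q a)"
      using Pp[of a] Pp[of b] Z by (simp add: PQ X_def d_def right_diff_distrib exp_diff)
    also have "\<dots> \<le> M" unfolding M_def
      using minP maxs Q_pos Pp Qp
      by (intro frac_le mult_mono mult_nonneg_nonneg mult_pos_pos) (auto simp: less_imp_le)
    finally show ?thesis .
  qed
  have "exp X \<le> 2 powr c"
  proof -
    have M1: "M \<ge> 1" using eX X_pos one_le_exp_iff[of X] by linarith
    \<comment> \<open>Two distinct letters make the exponent \<open>CARD('a) - 1\<close> at least 1,
      so \<open>M\<close> is at most its power \<open>2 powr c\<close>.\<close>
    have "a \<noteq> b" using b by auto
    then have "card {a, b} \<le> CARD('a)" by (intro card_mono) auto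
    then have "real CARD('a) - 1 \<ge> 1" using \<open>a \<noteq> b\<close> by simp
    then have "M powr 1 \<le> M powr (real CARD('a) - 1)" using M1 by (rule powr_mono)
    also have "\<dots> = 2 powr c"
      using M1 by (simp add: c_def \<open>Pstar = P\<close> M_def[symmetric] powr_def log_def)
    finally show ?thesis using eX M1 by simp
  qed
  then have powc: "2 * exp X \<le> 2 powr (c + 1)" by (simp add: powr_add)
  have "\<forall>\<^sub>F n in sequentially.
            kl_div (mean_type Q f I n) P \<le> kl_div (mean_type Q f I n) Q - kl_div P Q
          \<and> kl_div (mean_type Q f I n) Q - kl_div P Q < (1 / real n) * 2 powr (c + 1) * (1 + 0)"
    \<comment> \<open>The tolerance 1/12 and the 1 from \<open>eventually_mslack_le\<close> add up
      to the 13/12 in \<open>affine_less_exp\<close>.\<close>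
    using eventually_mtype_divergence[of "1 / 12", simplified] eventually_mslack_le eventually_Nrm_pos eventually_gt_at_top[of 0]
  proof eventually_elim
    case (elim n)
    have n: "n > 0" and N: "Nrm n > 0" using elim by auto
    have mt: "mean_type Q f I n = mtype n" using mean_type_eq_mtype[OF Z PQ n] by auto
    note pm = mtype_pmf[OF N n]
    have D: "kl_div (mtype n) Q - kl_div P Q = kl_div (mtype n) P + \<theta> * (mslack n / n) / ln 2"
      using diff[OF pm(1,2)] by (simp add: EP pm(3))
    have "kl_div (mtype n) P = (\<Sum>x\<in>UNIV. mtype n x * ln (mtype n x / P x)) / ln 2"
      by (rule kl_div_eq_sum_ln[OF pm(1)])
    then have "(kl_div (mtype n) Q - kl_div P Q) * (n * ln 2)
       = real n * (\<Sum>x\<in>UNIV. mtype n x * ln (mtype n x / P x)) + \<theta> * mslack n"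
      unfolding D using n by (simp add: field_simps)
    also have "\<dots> \<le> 2 * X + 13 / 12" using elim by simp
    also have "\<dots> < 2 * ln 2 * exp X" using X_pos by (intro affine_less_exp) simp
    also have "\<dots> \<le> ln 2 * 2 powr (c + 1)" using powc by (simp add: mult.commute)
    finally have "(kl_div (mtype n) Q - kl_div P Q) * n * ln 2 < 2 powr (c + 1) * ln 2"
      by (simp add: mult_ac)
    then have "(kl_div (mtype n) Q - kl_div P Q) * n < 2 powr (c + 1)" by simp
    then have "kl_div (mtype n) Q - kl_div P Q < 2 powr (c + 1) / n"
      using n by (simp add: pos_less_divide_eq)
    moreover have "\<theta> * (mslack n / n) / ln 2 \<ge> 0" using th mslack_nonneg[of n] by simp
    ultimately show ?case unfolding mt using D by simp
  qed
  then show ?thesis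
    unfolding \<open>Pstar = P\<close>
    by (intro conjI exI[of _ "\<lambda>_. 0"]) (auto elim: eventually_mono)
qed

end
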